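(* Let $(K,v)$ be a valued field and $\mathbf A$ a non-trivial approximation type over $(K,v)$. If $\mathbf A$ is value-extending, assume that $vK$ is dense; if $\mathbf A$ is residue-extending, assume that $Kv$ is infinite. Then $\mathbf A$ is realized in some elementary extension of $(K,v)$ by an element $x$ that is transcendental over $K$; that is, there are an elementary extension $(K^*,v)$ of $(K,v)$ and $x\in K^*$ transcendental over $K$ with $\mathrm{appr}_v(x,K)=\mathbf A$.
   Context: Valuations are Krull valuations written additively; $vK$ is the value group, $Kv$ the residue field, and $\infty$ is larger than all values. "Elementary extension" refers to a first-order language of valued fields: the language of rings (or fields) together with a unary predicate for the valuation ring or a binary relation $x\mid_v y\Leftrightarrow vx\le vy$. An ordered abelian group $\Gamma$ is called dense if for all $\gamma,\delta\in\Gamma$ with $\gamma<\delta$ there is $\beta\in\Gamma$ with $\gamma<\beta<\delta$. Balls: for $c\in K$, the closed ball of radius $\gamma\in vK\cup\{\infty\}$ is $B_\gamma(c,K)=\{a\in K\mid v(a-c)\ge\gamma\}$, and the open ball of radius $\gamma\in vK$ is $B^\circ_\gamma(c,K)=\{a\in K\mid v(a-c)>\gamma\}$. Balls are recorded together with their radius and their kind (open/closed). An approximation type $\mathbf A$ over $(K,v)$ is a (possibly empty) collection of closed and open balls in $(K,v)$, any two of which are comparable by inclusion, such that whenever $\mathbf A$ contains a (closed or open) ball with center $c$ and radius $\gamma$, it contains $B_\beta(c,K)$ and $B_\beta^\circ(c,K)$ for all $\beta\in vK$ with $\beta<\gamma$, and whenever it contains $B^\circ_\gamma(c,K)$ it contains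 $B_\gamma(c,K)$. Its support $\mathrm{supp}\,\mathbf A$ is the set of all $\gamma\in vK\cup\{\infty\}$ such that $\mathbf A$ contains a closed ball of radius $\gamma$; this ball is then unique and denoted $\mathbf A_\gamma$. If $\mathbf A$ contains an open ball of radius $\gamma$, it is unique and denoted $\mathbf A_\gamma^\circ$. Put $\mathbf A_\gamma=\emptyset$, resp. $\mathbf A_\gamma^\circ=\emptyset$, if there is no such ball. $\bigcap\mathbf A$ is the intersection of all balls in $\mathbf A$ (and $\bigcap\emptyset=K$). $\mathbf A$ is trivial if $\infty\in\mathrm{supp}\,\mathbf A$. For an extension $(L|K,v)$ of valued fields and $x\in L$, $\mathrm{appr}_v(x,K)$ is the approximation type over $(K,v)$ consisting of all nonempty sets $\{c\in K\mid v(x-c)\ge\gamma\}$, $\gamma\in vK\cup\{\infty\}$ (as closed balls of radius $\gamma$), and all nonempty sets $\{c\in K\mid v(x-c)>\gamma\}$, $\gamma\in vK$ (as open balls of radius $\gamma$). A non-trivial $\mathbf A$ is value-extending if $\mathbf A_\gamma^\circ\ne\emptyset$ for every $\gamma\in\mathrm{supp}\,\mathbf A$ and $\bigcap\mathbf A\neq\emptyset$ (so the empty type is value-extending); residue-extending if for every $c\in K$ there is $\gamma\in\mathrm{supp}\,\mathbf A$ with $c\in\mathbf A_\gamma\setminus\mathbf A_\gamma^\circ$, and $\bigcap\mathbf A\ne\emptyset$.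
   Formalization: In the value-extending case vK is also assumed to be nontrivial: for vK = {0}, vacuously dense, the value-extending types (the empty one and {K, {c}}) are never realized, since triviality of v passes to every elementary extension. *)

theory Defs
  imports "HOL-Algebra.Algebra"
begin

section \<open>Ordered abelian groups and valued fields\<close>

text \<open>
  Value groups are written additively on paper; here the group operation is the
  \<open>\<otimes>\<close> of a HOL-Algebra group, with neutral element \<open>\<one>\<close>. Carriers are
  explicit because the value group of the extension field is existentially quantified.
\<close>

record 'g ordered_group = "'g monoid" +
  gle :: "'g \<Rightarrow> 'g \<Rightarrow> bool" (infixl "\<preceq>\<index>" 50)

locale ordered_ab_group = comm_group G
  for G :: "('g, 'm) ordered_group_scheme" (structure) +
  assumes gle_refl: "a \<in> carrier G \<Longrightarrow> a \<preceq> a"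
    and gle_antisym: "\<lbrakk>a \<in> carrier G; b \<in> carrier G; a \<preceq> b; b \<preceq> a\<rbrakk> \<Longrightarrow> a = b"
    and gle_trans: "\<lbrakk>a \<in> carrier G; b \<in> carrier G; c \<in> carrier G; a \<preceq> b; b \<preceq> c\<rbrakk> \<Longrightarrow> a \<preceq> c"
    and gle_total: "\<lbrakk>a \<in> carrier G; b \<in> carrier G\<rbrakk> \<Longrightarrow> a \<preceq> b \<or> b \<preceq> a"
    and gle_mult: "\<lbrakk>a \<in> carrier G; b \<in> carrier G; c \<in> carrier G; a \<preceq> b\<rbrakk> \<Longrightarrow> a \<otimes> c \<preceq> b \<otimes> c"

definition gless :: "('g, 'm) ordered_group_scheme \<Rightarrow> 'g \<Rightarrow> 'g \<Rightarrow> bool" where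
  "gless G a b \<longleftrightarrow> a \<preceq>\<^bsub>G\<^esub> b \<and> a \<noteq> b"

text \<open>The trivial group is dense in this (order-theoretic) sense.\<close>

definition dense_group :: "('g, 'm) ordered_group_scheme \<Rightarrow> bool" where
  "dense_group G \<longleftrightarrow>
    (\<forall>a\<in>carrier G. \<forall>b\<in>carrier G. gless G a b \<longrightarrow>
      (\<exists>c\<in>carrier G. gless G a c \<and> gless G c b))"

datatype 'g ext_value = Val 'g | Infty

definition ext_values :: "('g, 'm) ordered_group_scheme \<Rightarrow> 'g ext_value set" where
  "ext_values G = insert Infty (Val ` carrier G)"

fun vle :: "('g, 'm) ordered_group_scheme \<Rightarrow> 'g ext_value \<Rightarrow> 'g ext_value \<Rightarrow> bool" where
  "vle G x Infty = True"
| "vle G Infty (Val b) = False"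
| "vle G (Val a) (Val b) = (a \<preceq>\<^bsub>G\<^esub> b)"

definition vless :: "('g, 'm) ordered_group_scheme \<Rightarrow> 'g ext_value \<Rightarrow> 'g ext_value \<Rightarrow> bool" where
  "vless G x y \<longleftrightarrow> vle G x y \<and> x \<noteq> y"

definition vmin :: "('g, 'm) ordered_group_scheme \<Rightarrow> 'g ext_value \<Rightarrow> 'g ext_value \<Rightarrow> 'g ext_value" where
  "vmin G x y = (if vle G x y then x else y)"

fun vadd :: "('g, 'm) ordered_group_scheme \<Rightarrow> 'g ext_value \<Rightarrow> 'g ext_value \<Rightarrow> 'g ext_value" where
  "vadd G (Val a) (Val b) = Val (a \<otimes>\<^bsub>G\<^esub> b)"
| "vadd G Infty y = Infty"
| "vadd G x Infty = Infty"

text \<open>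
  \<open>G\<close> is the value group itself, not merely an ordered group containing the values:
  \<open>v\<close> maps the nonzero elements onto it. Values of \<open>v\<close> outside \<open>carrier K\<close> are irrelevant.
\<close>

locale valued_field = field K + value_group: ordered_ab_group G
  for K :: "('a, 'n) ring_scheme" (structure)
    and G :: "('g, 'm) ordered_group_scheme"
    and v :: "'a \<Rightarrow> 'g ext_value" +
  assumes v_zero: "v \<zero> = Infty"
    and v_image: "v ` (carrier K - {\<zero>}) = Val ` carrier G"
    and v_mult: "\<lbrakk>a \<in> carrier K; b \<in> carrier K\<rbrakk> \<Longrightarrow> v (a \<otimes> b) = vadd G (v a) (v b)"
    and v_add: "\<lbrakk>a \<in> carrier K; b \<in> carrier K\<rbrakk> \<Longrightarrow> vle G (vmin G (v a) (v b)) (v (a \<oplus> b))"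

definition valuation_ring ::
  "('a, 'n) ring_scheme \<Rightarrow> ('g, 'm) ordered_group_scheme \<Rightarrow> ('a \<Rightarrow> 'g ext_value) \<Rightarrow> ('a, 'n) ring_scheme" where
  "valuation_ring K G v = K\<lparr>carrier := {a \<in> carrier K. vle G (Val \<one>\<^bsub>G\<^esub>) (v a)}\<rparr>"

definition valuation_ideal ::
  "('a, 'n) ring_scheme \<Rightarrow> ('g, 'm) ordered_group_scheme \<Rightarrow> ('a \<Rightarrow> 'g ext_value) \<Rightarrow> 'a set" where
  "valuation_ideal K G v = {a \<in> carrier K. vless G (Val \<one>\<^bsub>G\<^esub>) (v a)}"

definition residue_field ::
  "('a, 'n) ring_scheme \<Rightarrow> ('g, 'm) ordered_group_scheme \<Rightarrow> ('a \<Rightarrow> 'g ext_value) \<Rightarrow> 'a set ring" where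
  "residue_field K G v = valuation_ring K G v Quot valuation_ideal K G v"

text \<open>
  An extension is given by an embedding \<open>\<iota>\<close> of fields together with the embedding
  \<open>j\<close> of value groups along which \<open>w\<close> restricts to \<open>v\<close>.
\<close>

definition valued_field_extension ::
  "('a, 'n) ring_scheme \<Rightarrow> ('g, 'm) ordered_group_scheme \<Rightarrow> ('a \<Rightarrow> 'g ext_value) \<Rightarrow>
   ('b, 'p) ring_scheme \<Rightarrow> ('h, 'q) ordered_group_scheme \<Rightarrow> ('b \<Rightarrow> 'h ext_value) \<Rightarrow>
   ('a \<Rightarrow> 'b) \<Rightarrow> ('g \<Rightarrow> 'h) \<Rightarrow> bool" where
  "valued_field_extension K G v L H w \<iota> j \<longleftrightarrow>
    valued_field K G v \<and> valued_field L H w \<and>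
    \<iota> \<in> ring_hom K L \<and> inj_on \<iota> (carrier K) \<and>
    j \<in> hom G H \<and>
    (\<forall>a\<in>carrier G. \<forall>b\<in>carrier G. a \<preceq>\<^bsub>G\<^esub> b \<longleftrightarrow> j a \<preceq>\<^bsub>H\<^esub> j b) \<and>
    (\<forall>a\<in>carrier K. w (\<iota> a) = map_ext_value j (v a))"


section \<open>The first-order language of valued fields\<close>

text \<open>The language of rings with the binary relation \<open>x |\<^sub>v y \<longleftrightarrow> v x \<le> v y\<close>.\<close>

datatype vf_term =
    TVar nat
  | TZero
  | TOne
  | TAdd vf_term vf_term
  | TMinus vf_term
  | TMult vf_term vf_term

datatype vf_formula =
    FEq vf_term vf_term
  | FVdvd vf_term vf_term
  | FNot vf_formula
  | FAnd vf_formula vf_formula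
  | FAll nat vf_formula

fun interp :: "('a, 'n) ring_scheme \<Rightarrow> (nat \<Rightarrow> 'a) \<Rightarrow> vf_term \<Rightarrow> 'a" where
  "interp K e (TVar n) = e n"
| "interp K e TZero = \<zero>\<^bsub>K\<^esub>"
| "interp K e TOne = \<one>\<^bsub>K\<^esub>"
| "interp K e (TAdd s t) = interp K e s \<oplus>\<^bsub>K\<^esub> interp K e t"
| "interp K e (TMinus t) = \<ominus>\<^bsub>K\<^esub> interp K e t"
| "interp K e (TMult s t) = interp K e s \<otimes>\<^bsub>K\<^esub> interp K e t"

fun sat :: "('a, 'n) ring_scheme \<Rightarrow> ('g, 'm) ordered_group_scheme \<Rightarrow> ('a \<Rightarrow> 'g ext_value) \<Rightarrow>
    (nat \<Rightarrow> 'a) \<Rightarrow> vf_formula \<Rightarrow> bool" where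
  "sat K G v e (FEq s t) \<longleftrightarrow> interp K e s = interp K e t"
| "sat K G v e (FVdvd s t) \<longleftrightarrow> vle G (v (interp K e s)) (v (interp K e t))"
| "sat K G v e (FNot \<phi>) \<longleftrightarrow> \<not> sat K G v e \<phi>"
| "sat K G v e (FAnd \<phi> \<psi>) \<longleftrightarrow> sat K G v e \<phi> \<and> sat K G v e \<psi>"
| "sat K G v e (FAll n \<phi>) \<longleftrightarrow> (\<forall>a\<in>carrier K. sat K G v (e(n := a)) \<phi>)"

definition elementary_extension ::
  "('a, 'n) ring_scheme \<Rightarrow> ('g, 'm) ordered_group_scheme \<Rightarrow> ('a \<Rightarrow> 'g ext_value) \<Rightarrow>
   ('b, 'p) ring_scheme \<Rightarrow> ('h, 'q) ordered_group_scheme \<Rightarrow> ('b \<Rightarrow> 'h ext_value) \<Rightarrow>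
   ('a \<Rightarrow> 'b) \<Rightarrow> ('g \<Rightarrow> 'h) \<Rightarrow> bool" where
  "elementary_extension K G v L H w \<iota> j \<longleftrightarrow>
    valued_field_extension K G v L H w \<iota> j \<and>
    (\<forall>\<phi> e. range e \<subseteq> carrier K \<longrightarrow> (sat K G v e \<phi> \<longleftrightarrow> sat L H w (\<iota> \<circ> e) \<phi>))"


section \<open>Approximation types\<close>

text \<open>A ball is recorded as a triple consisting of its kind, its radius and its set of elements.\<close>

datatype ball_kind = Closed | Open

type_synonym ('a, 'g) vball = "ball_kind \<times> 'g ext_value \<times> 'a set"

definition closed_ball ::
  "('a, 'n) ring_scheme \<Rightarrow> ('g, 'm) ordered_group_scheme \<Rightarrow> ('a \<Rightarrow> 'g ext_value) \<Rightarrow>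
   'a \<Rightarrow> 'g ext_value \<Rightarrow> ('a, 'g) vball" where
  "closed_ball K G v c \<gamma> = (Closed, \<gamma>, {a \<in> carrier K. vle G \<gamma> (v (a \<ominus>\<^bsub>K\<^esub> c))})"

definition open_ball ::
  "('a, 'n) ring_scheme \<Rightarrow> ('g, 'm) ordered_group_scheme \<Rightarrow> ('a \<Rightarrow> 'g ext_value) \<Rightarrow>
   'a \<Rightarrow> 'g ext_value \<Rightarrow> ('a, 'g) vball" where
  "open_ball K G v c \<gamma> = (Open, \<gamma>, {a \<in> carrier K. vless G \<gamma> (v (a \<ominus>\<^bsub>K\<^esub> c))})"

definition vballs ::
  "('a, 'n) ring_scheme \<Rightarrow> ('g, 'm) ordered_group_scheme \<Rightarrow> ('a \<Rightarrow> 'g ext_value) \<Rightarrow> ('a, 'g) vball set" where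
  "vballs K G v =
     {closed_ball K G v c \<gamma> | c \<gamma>. c \<in> carrier K \<and> \<gamma> \<in> ext_values G} \<union>
     {open_ball K G v c \<gamma> | c \<gamma>. c \<in> carrier K \<and> \<gamma> \<in> Val ` carrier G}"

definition approximation_type ::
  "('a, 'n) ring_scheme \<Rightarrow> ('g, 'm) ordered_group_scheme \<Rightarrow> ('a \<Rightarrow> 'g ext_value) \<Rightarrow>
   ('a, 'g) vball set \<Rightarrow> bool" where
  "approximation_type K G v A \<longleftrightarrow>
    A \<subseteq> vballs K G v \<and>
    (\<forall>k \<gamma> S k' \<gamma>' S'. (k, \<gamma>, S) \<in> A \<and> (k', \<gamma>', S') \<in> A \<longrightarrow> S \<subseteq> S' \<or> S' \<subseteq> S) \<and>
    (\<forall>c\<in>carrier K. \<forall>\<gamma>\<in>ext_values G.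
       closed_ball K G v c \<gamma> \<in> A \<or> open_ball K G v c \<gamma> \<in> A \<longrightarrow>
       (\<forall>\<beta>\<in>Val ` carrier G. vless G \<beta> \<gamma> \<longrightarrow>
          closed_ball K G v c \<beta> \<in> A \<and> open_ball K G v c \<beta> \<in> A)) \<and>
    (\<forall>c\<in>carrier K. \<forall>\<gamma>\<in>Val ` carrier G.
       open_ball K G v c \<gamma> \<in> A \<longrightarrow> closed_ball K G v c \<gamma> \<in> A)"

definition supp :: "('a, 'g) vball set \<Rightarrow> 'g ext_value set" where
  "supp A = {\<gamma>. \<exists>S. (Closed, \<gamma>, S) \<in> A}"

text \<open>
  \<open>ball_at A Closed \<gamma>\<close> and \<open>ball_at A Open \<gamma>\<close> are
  \<open>A\<^sub>\<gamma>\<close> and \<open>A\<^sub>\<gamma>\<close> with a superscript circle, respectively.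
\<close>

definition ball_at :: "('a, 'g) vball set \<Rightarrow> ball_kind \<Rightarrow> 'g ext_value \<Rightarrow> 'a set" where
  "ball_at A k \<gamma> = (if \<exists>S. (k, \<gamma>, S) \<in> A then THE S. (k, \<gamma>, S) \<in> A else {})"

definition inter_balls :: "('a, 'n) ring_scheme \<Rightarrow> ('a, 'g) vball set \<Rightarrow> 'a set" where
  "inter_balls K A = {a \<in> carrier K. \<forall>k \<gamma> S. (k, \<gamma>, S) \<in> A \<longrightarrow> a \<in> S}"

definition trivial_type :: "('a, 'g) vball set \<Rightarrow> bool" where
  "trivial_type A \<longleftrightarrow> Infty \<in> supp A"

definition value_extending :: "('a, 'n) ring_scheme \<Rightarrow> ('a, 'g) vball set \<Rightarrow> bool" where
  "value_extending K A \<longleftrightarrow>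
    \<not> trivial_type A \<and> (\<forall>\<gamma>\<in>supp A. ball_at A Open \<gamma> \<noteq> {}) \<and> inter_balls K A \<noteq> {}"

definition residue_extending :: "('a, 'n) ring_scheme \<Rightarrow> ('a, 'g) vball set \<Rightarrow> bool" where
  "residue_extending K A \<longleftrightarrow>
    \<not> trivial_type A \<and>
    (\<forall>c\<in>carrier K. \<exists>\<gamma>\<in>supp A. c \<in> ball_at A Closed \<gamma> - ball_at A Open \<gamma>) \<and>
    inter_balls K A \<noteq> {}"

text \<open>
  The approximation type of \<open>x\<close> over the base field \<open>K\<close>, for an extension \<open>(L, H, w)\<close>
  with embeddings \<open>\<iota>\<close> and \<open>j\<close>.
\<close>

definition appr ::
  "('a, 'n) ring_scheme \<Rightarrow> ('g, 'm) ordered_group_scheme \<Rightarrow>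
   ('b, 'p) ring_scheme \<Rightarrow> ('h, 'q) ordered_group_scheme \<Rightarrow> ('b \<Rightarrow> 'h ext_value) \<Rightarrow>
   ('a \<Rightarrow> 'b) \<Rightarrow> ('g \<Rightarrow> 'h) \<Rightarrow> 'b \<Rightarrow> ('a, 'g) vball set" where
  "appr K G L H w \<iota> j x =
     {(Closed, \<gamma>, S) | \<gamma> S. \<gamma> \<in> ext_values G \<and>
        S = {c \<in> carrier K. vle H (map_ext_value j \<gamma>) (w (x \<ominus>\<^bsub>L\<^esub> \<iota> c))} \<and> S \<noteq> {}} \<union>
     {(Open, \<gamma>, S) | \<gamma> S. \<gamma> \<in> Val ` carrier G \<and>
        S = {c \<in> carrier K. vless H (map_ext_value j \<gamma>) (w (x \<ominus>\<^bsub>L\<^esub> \<iota> c))} \<and> S \<noteq> {}}"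

end

theory Submission
  imports Defs
begin

text \<open>
  The theorem is a compactness argument, and the elementary extension is an ultrapower.

  An element \<open>x\<close> of an extension realizes \<open>A\<close> if and only if it lies in every ball that
  belongs to \<open>A\<close> and outside every ball that does not. Suppose that any finitely many of
  these conditions are satisfied by a common element of \<open>K\<close>. Then there is an ultrafilter on
  \<open>K\<close> that contains the balls in \<open>A\<close> and the complements of all other balls
  (\<open>ultrafilter_of_type\<close>), and in the ultrapower of \<open>K\<close> modulo this ultrafilter the class of the
  identity function satisfies all conditions at once (\<open>appr_elem\<close>). The ultrapower is an
  elementary extension by \<open>Los\<close>. The type \<open>A\<close> is not trivial, so no ball of radius
  \<open>\<infinity>\<close>, that is, no point of \<open>K\<close>, belongs to \<open>A\<close>. Therefore the class is distinct from
  all constants, and it is transcendental because a nonzero polynomial has only finitely many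
  roots in \<open>K\<close>, which an ultrafilter can tell apart (\<open>transcendental_elem\<close>).

  It remains to see that the smallest of finitely many balls in \<open>A\<close>, or \<open>K\<close> itself, is
  not covered by finitely many balls outside \<open>A\<close>. If no point lies in all balls of \<open>A\<close>, one can pass to a ball
  of \<open>A\<close> that is disjoint from all balls to be avoided
  (\<open>satisfiable_if_no_common_point\<close>). If some \<open>c\<close> lies in all balls of \<open>A\<close> and \<open>A\<close> is
  value-extending, \<open>A\<close> is a cut in the value group seen from \<open>c\<close>, and it suffices to
  find a suitable distance to \<open>c\<close>; density makes finite cuts nonempty
  (\<open>satisfiable_if_value_extending\<close>). Otherwise \<open>A\<close> has a smallest ball, which is closed. The
  balls outside \<open>A\<close> that meet it lie in single cosets of the open ball of the same
  radius, and there are as many such cosets as elements of the residue field, infinitely many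
  (\<open>satisfiable_if_smallest_ball\<close>).
\<close>

section \<open>Ultrafilters\<close>

locale ultrafilter =
  fixes U :: "'i filter"
  assumes not_bot: "U \<noteq> bot"
    and decides: "eventually P U \<or> eventually (\<lambda>i. \<not> P i) U"
begin

lemma eventually_not_iff: "eventually (\<lambda>i. \<not> P i) U \<longleftrightarrow> \<not> eventually P U"
proof
  assume "eventually (\<lambda>i. \<not> P i) U"
  show "\<not> eventually P U"
  proof
    assume "eventually P U"
    with \<open>eventually (\<lambda>i. \<not> P i) U\<close> have "eventually (\<lambda>i. False) U"
      by eventually_elim simp
    then show False
      using not_bot by (simp add: trivial_limit_def)
  qed
qed (use decides in blast)

lemma eventually_const_iff: "eventually (\<lambda>i. c) U \<longleftrightarrow> c"
  using not_bot by (simp add: eventually_const_iff)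

lemma eventually_disj_iff:
  "eventually (\<lambda>i. P i \<or> Q i) U \<longleftrightarrow> eventually P U \<or> eventually Q U"
  using eventually_not_iff[of "\<lambda>i. \<not> P i \<and> \<not> Q i"]
  by (simp add: eventually_conj_iff eventually_not_iff)

end

lemma ultrafilter_filtermap:
  assumes "ultrafilter U"
  shows "ultrafilter (filtermap h U)"
proof -
  interpret ultrafilter U by fact
  show ?thesis
    using not_bot decides
    by unfold_locales (auto simp: filtermap_bot_iff eventually_filtermap)
qed

text \<open>
  By Zorn's lemma the family extends to a maximal one with the finite intersection
  property. Maximality makes the filter generated by it decide every predicate: a set
  that cannot be added misses a finite intersection of members, so that its complement
  is large.
\<close>

lemma ultrafilter_extending:
  assumes fip: "\<And>T. finite T \<Longrightarrow> T \<subseteq> F \<Longrightarrow> \<Inter>T \<noteq> {}"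
  obtains U where "ultrafilter U" and "\<And>S. S \<in> F \<Longrightarrow> eventually (\<lambda>i. i \<in> S) U"
proof -
  define fips where "fips = {M. F \<subseteq> M \<and> (\<forall>T. finite T \<longrightarrow> T \<subseteq> M \<longrightarrow> \<Inter>T \<noteq> {})}"
  have "\<exists>M\<in>fips. \<forall>N\<in>fips. M \<subseteq> N \<longrightarrow> N = M"
  proof (rule subset_Zorn_nonempty)
    show "fips \<noteq> {}"
      using fip by (auto simp: fips_def)
  next
    fix C assume C: "C \<noteq> {}" "subset.chain fips C"
    have "\<Inter>T \<noteq> {}" if T: "finite T" "T \<subseteq> \<Union>C" for T
    proof -
      obtain M where "M \<in> C" "T \<subseteq> M"
        using finite_subset_Union_chain[OF T C] by metis
      then show ?thesis
        using C T unfolding fips_def subset.chain_def by blast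
    qed
    moreover have "F \<subseteq> \<Union>C"
      using C unfolding fips_def subset.chain_def by blast
    ultimately show "\<Union>C \<in> fips"
      by (simp add: fips_def)
  qed
  then obtain M where M: "M \<in> fips" and max: "\<And>N. N \<in> fips \<Longrightarrow> M \<subseteq> N \<Longrightarrow> N = M"
    by blast
  define U where "U = (INF S\<in>M. principal S)"
  have ev: "eventually P U" if "finite T" "T \<subseteq> M" "\<And>i. i \<in> \<Inter>T \<Longrightarrow> P i" for P T
  proof -
    have "eventually P (INF S\<in>T. principal S)"
      using that by (auto simp: INF_principal_finite eventually_principal)
    then show ?thesis
      unfolding U_def using that by (subst eventually_INF) blast
  qed
  have "ultrafilter U"
  proof
    show "U \<noteq> bot"
      unfolding U_def
    proof (rule INF_filter_not_bot)
      fix T assume T: "T \<subseteq> M" "finite T"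
      then have "\<Inter>T \<noteq> {}"
        using M unfolding fips_def by blast
      then show "(INF S\<in>T. principal S) \<noteq> bot"
        using INF_principal_finite[OF T(2), of "\<lambda>S. S"] by (simp add: principal_eq_bot_iff)
    qed
    show "eventually P U \<or> eventually (\<lambda>i. \<not> P i) U" for P
    proof (cases "Collect P \<in> M")
      case True
      then show ?thesis
        using ev[of "{Collect P}" P] by simp
    next
      case False
      then have "insert (Collect P) M \<notin> fips"
        using max by blast
      then obtain T where T: "finite T" "T \<subseteq> insert (Collect P) M" "\<Inter>T = {}"
        using M by (auto simp: fips_def)
      then have "eventually (\<lambda>i. \<not> P i) U"
        by (intro ev[of "T - {Collect P}"]) auto
      then show ?thesis ..
    qed
  qed
  moreover have "eventually (\<lambda>i. i \<in> S) U" if "S \<in> F" for S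
    using M that by (intro ev[of "{S}"]) (auto simp: fips_def)
  ultimately show thesis
    using that by blast
qed

section \<open>Linear orders on value groups\<close>

context ordered_ab_group
begin

lemma vle_refl: "x \<in> ext_values G \<Longrightarrow> vle G x x"
  by (cases x) (auto simp: ext_values_def gle_refl)

lemma vle_antisym: "\<lbrakk>x \<in> ext_values G; y \<in> ext_values G; vle G x y; vle G y x\<rbrakk> \<Longrightarrow> x = y"
  by (cases x; cases y) (auto simp: ext_values_def gle_antisym)

lemma vle_trans:
  "\<lbrakk>x \<in> ext_values G; y \<in> ext_values G; z \<in> ext_values G; vle G x y; vle G y z\<rbrakk> \<Longrightarrow> vle G x z"
  by (cases x; cases y; cases z) (auto simp: ext_values_def intro: gle_trans)

lemma vle_total: "\<lbrakk>x \<in> ext_values G; y \<in> ext_values G\<rbrakk> \<Longrightarrow> vle G x y \<or> vle G y x"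
  by (cases x; cases y) (auto simp: ext_values_def dest: gle_total)

lemma not_vle_iff: "\<lbrakk>x \<in> ext_values G; y \<in> ext_values G\<rbrakk> \<Longrightarrow> \<not> vle G x y \<longleftrightarrow> vless G y x"
  unfolding vless_def using vle_antisym vle_total vle_refl by blast

lemma vless_vle_trans:
  "\<lbrakk>x \<in> ext_values G; y \<in> ext_values G; z \<in> ext_values G; vless G x y; vle G y z\<rbrakk> \<Longrightarrow> vless G x z"
  unfolding vless_def using vle_trans vle_antisym by blast

lemma vle_vless_trans:
  "\<lbrakk>x \<in> ext_values G; y \<in> ext_values G; z \<in> ext_values G; vle G x y; vless G y z\<rbrakk> \<Longrightarrow> vless G x z"
  unfolding vless_def using vle_trans vle_antisym by blast

lemma gless_trans:
  "\<lbrakk>x \<in> carrier G; y \<in> carrier G; z \<in> carrier G; gless G x y; gless G y z\<rbrakk> \<Longrightarrow> gless G x z"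
  unfolding gless_def using gle_trans gle_antisym by blast

lemma gless_gle_trans:
  "\<lbrakk>x \<in> carrier G; y \<in> carrier G; z \<in> carrier G; gless G x y; y \<preceq> z\<rbrakk> \<Longrightarrow> gless G x z"
  unfolding gless_def using gle_trans gle_antisym by blast

lemma gle_gless_trans:
  "\<lbrakk>x \<in> carrier G; y \<in> carrier G; z \<in> carrier G; x \<preceq> y; gless G y z\<rbrakk> \<Longrightarrow> gless G x z"
  unfolding gless_def using gle_trans gle_antisym by blast

lemma gless_mult:
  "\<lbrakk>a \<in> carrier G; b \<in> carrier G; c \<in> carrier G; gless G a b\<rbrakk> \<Longrightarrow> gless G (a \<otimes> c) (b \<otimes> c)"
  unfolding gless_def using gle_mult by auto

text \<open>
  Ordered groups have no 2-torsion. This determines the value of the element \<open>-1\<close>, whose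
  square is \<open>1\<close>, and hence makes the distance between two elements symmetric.
\<close>

lemma square_eq_one:
  assumes "a \<in> carrier G" "a \<otimes> a = \<one>"
  shows "a = \<one>"
proof (rule ccontr)
  assume "a \<noteq> \<one>"
  then consider "gless G \<one> a" | "gless G a \<one>"
    using gle_total[of a \<one>] assms by (auto simp: gless_def)
  then show False
  proof cases
    case 1
    then show False
      using gless_mult[of \<one> a a] gless_trans[of \<one> a \<one>] assms by (auto simp: gless_def)
  next
    case 2
    then show False
      using gless_mult[of a \<one> a] gless_trans[of \<one> a \<one>] assms by (auto simp: gless_def)
  qed
qed

lemma no_endpoints:
  assumes "carrier G \<noteq> {\<one>}" "a \<in> carrier G"
  shows "\<exists>b\<in>carrier G. gless G b a" "\<exists>b\<in>carrier G. gless G a b"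
proof -
  obtain g where g: "g \<in> carrier G" "g \<noteq> \<one>"
    using assms one_closed by blast
  have "\<exists>p\<in>carrier G. gless G \<one> p"
  proof (cases "\<one> \<preceq> g")
    case True
    then show ?thesis using g by (auto simp: gless_def)
  next
    case False
    then have "gless G g \<one>"
      using g gle_total[of g \<one>] by (auto simp: gless_def)
    then have "gless G \<one> (inv g)"
      using gless_mult[of g \<one> "inv g"] g by simp
    then show ?thesis using g by blast
  qed
  then obtain p where p: "p \<in> carrier G" "gless G \<one> p" by blast
  have "gless G a (p \<otimes> a)"
    using gless_mult[of \<one> p a] p assms by simp
  then show "\<exists>b\<in>carrier G. gless G a b"
    using p assms by blast
  have "gless G (inv p) \<one>"
    using gless_mult[of \<one> p "inv p"] p by simp
  then have "gless G (inv p \<otimes> a) a"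
    using gless_mult[of "inv p" \<one> a] p assms by simp
  then show "\<exists>b\<in>carrier G. gless G b a"
    using p assms by blast
qed

lemma finite_has_greatest:
  assumes "finite T" "T \<noteq> {}" "T \<subseteq> carrier G"
  shows "\<exists>m\<in>T. \<forall>x\<in>T. x \<preceq> m"
  using assms
proof (induction rule: finite_ne_induct)
  case (insert x T)
  then obtain m where m: "m \<in> T" "\<forall>y\<in>T. y \<preceq> m" by blast
  show ?case
  proof (cases "x \<preceq> m")
    case False
    then have "m \<preceq> x"
      using m insert.prems gle_total by blast
    then have "\<forall>y\<in>insert x T. y \<preceq> x"
      using m insert.prems gle_trans[of _ m x] gle_refl by (metis in_mono insert_iff)
    then show ?thesis by blast
  qed (use m in auto)
qed (auto simp: gle_refl)

lemma finite_has_least: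
  assumes "finite T" "T \<noteq> {}" "T \<subseteq> carrier G"
  shows "\<exists>m\<in>T. \<forall>x\<in>T. m \<preceq> x"
  using assms
proof (induction rule: finite_ne_induct)
  case (insert x T)
  then obtain m where m: "m \<in> T" "\<forall>y\<in>T. m \<preceq> y" by blast
  show ?case
  proof (cases "m \<preceq> x")
    case False
    then have "x \<preceq> m"
      using m insert.prems gle_total by blast
    then have "\<forall>y\<in>insert x T. x \<preceq> y"
      using m insert.prems gle_trans[of x m] gle_refl by (metis in_mono insert_iff)
    then show ?thesis by blast
  qed (use m in auto)
qed (auto simp: gle_refl)

text \<open>
  In a nontrivial dense ordered group no finite cut is empty, not even one with an empty
  side, since translating by an element different from the neutral one shows that the
  order has no endpoints.
\<close>

lemma between_finite_sets:
  assumes dense: "dense_group G" and nontriv: "carrier G \<noteq> {\<one>}"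
    and Lo: "finite Lo" "Lo \<subseteq> carrier G"
    and Hi: "finite Hi" "Hi \<subseteq> carrier G"
    and less: "\<And>l h. l \<in> Lo \<Longrightarrow> h \<in> Hi \<Longrightarrow> gless G l h"
  shows "\<exists>m\<in>carrier G. (\<forall>l\<in>Lo. gless G l m) \<and> (\<forall>h\<in>Hi. gless G m h)"
proof -
  have *: "\<exists>m\<in>carrier G. (\<forall>l\<in>Lo. gless G l m) \<and> (\<forall>h\<in>Hi. gless G m h)"
    if "l \<in> carrier G" "h \<in> carrier G" "gless G l h" "\<forall>x\<in>Lo. x \<preceq> l" "\<forall>x\<in>Hi. h \<preceq> x" for l h
  proof -
    obtain m where "m \<in> carrier G" "gless G l m" "gless G m h"
      using dense \<open>l \<in> carrier G\<close> \<open>h \<in> carrier G\<close> \<open>gless G l h\<close> unfolding dense_group_def by blast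
    then show ?thesis
      using that Lo Hi
      by (intro bexI[of _ m]) (auto intro: gle_gless_trans[of _ l m] gless_gle_trans[of m h])
  qed
  consider "Lo = {}" "Hi = {}" | "Lo = {}" "Hi \<noteq> {}" | "Lo \<noteq> {}" "Hi = {}" | "Lo \<noteq> {}" "Hi \<noteq> {}"
    by blast
  then show ?thesis
  proof cases
    case 1
    then show ?thesis by auto
  next
    case 2
    then obtain h where h: "h \<in> Hi" "\<forall>x\<in>Hi. h \<preceq> x"
      using finite_has_least Hi by blast
    moreover obtain l where "l \<in> carrier G" "gless G l h"
      using no_endpoints(1)[OF nontriv] h Hi by blast
    ultimately show ?thesis
      using * 2 Hi by blast
  next
    case 3
    then obtain l where l: "l \<in> Lo" "\<forall>x\<in>Lo. x \<preceq> l"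
      using finite_has_greatest Lo by blast
    moreover obtain h where "h \<in> carrier G" "gless G l h"
      using no_endpoints(2)[OF nontriv] l Lo by blast
    ultimately show ?thesis
      using * 3 Lo by blast
  next
    case 4
    then obtain l h where "l \<in> Lo" "\<forall>x\<in>Lo. x \<preceq> l" "h \<in> Hi" "\<forall>x\<in>Hi. h \<preceq> x"
      using finite_has_greatest Lo finite_has_least Hi by meson
    then show ?thesis
      using * less Lo Hi by blast
  qed
qed

text \<open>
  Finitely many forbidden values do not obstruct a cut: those below the upper side are
  added to the lower side, and no other value can lie in the cut.
\<close>

lemma between_avoiding:
  assumes dense: "dense_group G" and nontriv: "carrier G \<noteq> {\<one>}"
    and Lo: "finite Lo" "Lo \<subseteq> Val ` carrier G"
    and Hi: "finite Hi" "Hi \<subseteq> ext_values G"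
    and less: "\<And>l h. l \<in> Lo \<Longrightarrow> h \<in> Hi \<Longrightarrow> vless G l h"
    and D: "finite D"
  shows "\<exists>m\<in>carrier G. (\<forall>l\<in>Lo. vless G l (Val m)) \<and> (\<forall>h\<in>Hi. vless G (Val m) h) \<and> Val m \<notin> D"
proof -
  define hi where "hi = {g \<in> carrier G. Val g \<in> Hi}"
  define lo where "lo = {g \<in> carrier G. Val g \<in> Lo \<or> (Val g \<in> D \<and> (\<forall>h\<in>hi. gless G g h))}"
  have inj: "inj_on Val B" for B :: "'a set"
    by (rule inj_onI) simp
  have fin: "finite {g \<in> carrier G. Val g \<in> Y}" if "finite Y" for Y
    by (rule finite_imageD[OF finite_subset[OF _ that] inj]) auto
  have "finite lo"
    unfolding lo_def by (rule finite_subset[OF _ fin[of "Lo \<union> D"]]) (use Lo D in auto)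
  have *: "gless G l h" if "l \<in> lo" "h \<in> hi" for l h
    using that less[of "Val l" "Val h"] unfolding lo_def hi_def
    by (auto simp: vless_def gless_def)
  obtain m where m: "m \<in> carrier G" "\<forall>l\<in>lo. gless G l m" "\<forall>h\<in>hi. gless G m h"
  proof -
    have "lo \<subseteq> carrier G" "finite hi" "hi \<subseteq> carrier G"
      using fin[OF Hi(1)] unfolding lo_def hi_def by blast+
    then show thesis
      using between_finite_sets[OF dense nontriv \<open>finite lo\<close>, of hi] that * by blast
  qed
  have "vless G l (Val m)" if "l \<in> Lo" for l
  proof -
    obtain g where "l = Val g" "g \<in> carrier G"
      using Lo \<open>l \<in> Lo\<close> by blast
    then show ?thesis
      using m(2) that by (auto simp: vless_def gless_def lo_def)
  qed
  moreover have "vless G (Val m) h" if "h \<in> Hi" for h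
    using m(3) that Hi by (cases h) (auto simp: vless_def gless_def hi_def ext_values_def)
  moreover have "Val m \<notin> D"
    using m by (auto simp: lo_def gless_def)
  ultimately show ?thesis
    using m(1) by blast
qed

end

section \<open>Valuations and balls\<close>

context valued_field
begin

lemma v_nonzero:
  assumes "a \<in> carrier K" "a \<noteq> \<zero>"
  obtains g where "g \<in> carrier G" "v a = Val g"
proof -
  have "v a \<in> v ` (carrier K - {\<zero>})"
    using assms by auto
  then show thesis
    using that by (auto simp: v_image)
qed

lemma v_closed:
  assumes "a \<in> carrier K"
  shows "v a \<in> ext_values G"
proof (cases "a = \<zero>")
  case False
  then show ?thesis
    using v_nonzero[OF assms] by (auto simp: ext_values_def)
qed (simp add: v_zero ext_values_def)

lemma v_eq_Infty_iff:
  assumes "a \<in> carrier K"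
  shows "v a = Infty \<longleftrightarrow> a = \<zero>"
  using v_nonzero[OF assms] v_zero by force

lemma v_surj:
  assumes "g \<in> carrier G"
  obtains a where "a \<in> carrier K" "v a = Val g"
proof -
  have "Val g \<in> v ` (carrier K - {\<zero>})"
    using assms by (simp add: v_image)
  then show thesis
    using that by force
qed

lemma v_one: "v \<one> = Val \<one>\<^bsub>G\<^esub>"
proof -
  obtain g where g: "g \<in> carrier G" "v \<one> = Val g"
    using v_nonzero[OF one_closed one_not_zero] .
  then have "g \<otimes>\<^bsub>G\<^esub> g = g"
    using v_mult[of \<one> \<one>] by simp
  then show ?thesis
    using g value_group.l_cancel_one[of g g] by simp
qed

lemma v_minus_one: "v (\<ominus> \<one>) = Val \<one>\<^bsub>G\<^esub>"
proof -
  have nz: "\<ominus> \<one> \<noteq> \<zero>"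
  proof
    assume "\<ominus> \<one> = \<zero>"
    then have "\<ominus> (\<ominus> \<one>) = \<zero>"
      by simp
    then show False
      using one_not_zero by (simp del: add.inv_eq_1_iff)
  qed
  then obtain g where g: "g \<in> carrier G" "v (\<ominus> \<one>) = Val g"
    using v_nonzero[OF a_inv_closed[OF one_closed]] by blast
  have "\<ominus> \<one> \<otimes> \<ominus> \<one> = \<one>"
    by (simp add: l_minus)
  then have "g \<otimes>\<^bsub>G\<^esub> g = \<one>\<^bsub>G\<^esub>"
    using v_mult[OF a_inv_closed a_inv_closed, OF one_closed one_closed] g(2) v_one by simp
  then show ?thesis
    using value_group.square_eq_one[OF g(1)] g(2) by simp
qed

lemma v_uminus:
  assumes "a \<in> carrier K"
  shows "v (\<ominus> a) = v a"
proof -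
  have "v (\<ominus> a) = vadd G (Val \<one>\<^bsub>G\<^esub>) (v a)"
    using v_mult[of "\<ominus> \<one>" a] assms v_minus_one by (simp add: l_minus)
  then show ?thesis
    using v_closed[OF assms] by (cases "v a") (auto simp: ext_values_def)
qed

lemma minus_minus_swap:
  assumes "a \<in> carrier K" "b \<in> carrier K"
  shows "v (a \<ominus> b) = v (b \<ominus> a)"
proof -
  have "b \<ominus> a = \<ominus> (a \<ominus> b)"
    using assms by (simp add: minus_eq minus_add a_comm)
  then show ?thesis
    using v_uminus[of "a \<ominus> b"] assms by simp
qed

text \<open>
  Closed and open balls obey the same laws, so that both are treated at once:
  \<open>in_radius k \<gamma> \<delta>\<close> says that an element at distance \<open>\<delta>\<close> from a center lies
  in the ball of kind \<open>k\<close> and radius \<open>\<gamma>\<close> around it.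
\<close>

definition in_radius :: "ball_kind \<Rightarrow> 'g ext_value \<Rightarrow> 'g ext_value \<Rightarrow> bool" where
  "in_radius k \<gamma> \<delta> \<longleftrightarrow> (case k of Closed \<Rightarrow> vle G \<gamma> \<delta> | Open \<Rightarrow> vless G \<gamma> \<delta>)"

definition radii :: "ball_kind \<Rightarrow> 'g ext_value set" where
  "radii k = (case k of Closed \<Rightarrow> ext_values G | Open \<Rightarrow> Val ` carrier G)"

definition ball :: "ball_kind \<Rightarrow> 'a \<Rightarrow> 'g ext_value \<Rightarrow> ('a, 'g) vball" where
  "ball k c \<gamma> = (k, \<gamma>, {a \<in> carrier K. in_radius k \<gamma> (v (a \<ominus> c))})"

lemma ball_simps:
  "ball Closed c \<gamma> = closed_ball K G v c \<gamma>"
  "ball Open c \<gamma> = open_ball K G v c \<gamma>"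
  by (simp_all add: ball_def closed_ball_def open_ball_def in_radius_def)

lemma radii_subset: "\<gamma> \<in> radii k \<Longrightarrow> \<gamma> \<in> ext_values G"
  by (auto simp: radii_def ext_values_def split: ball_kind.splits)

lemma vballs_eq: "vballs K G v = {ball k c \<gamma> | k c \<gamma>. c \<in> carrier K \<and> \<gamma> \<in> radii k}"
proof -
  have "ball k c \<gamma> \<in> vballs K G v" if "c \<in> carrier K" "\<gamma> \<in> radii k" for k c \<gamma>
    using that by (cases k) (auto simp: vballs_def radii_def ball_simps)
  moreover have "y \<in> {ball k c \<gamma> | k c \<gamma>. c \<in> carrier K \<and> \<gamma> \<in> radii k}"
    if y: "y \<in> vballs K G v" for y
  proof -
    consider c \<gamma> where "y = ball Closed c \<gamma>" "c \<in> carrier K" "\<gamma> \<in> radii Closed"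
      | c \<gamma> where "y = ball Open c \<gamma>" "c \<in> carrier K" "\<gamma> \<in> radii Open"
      using y by (auto simp: vballs_def radii_def ball_simps)
    then show ?thesis by cases blast+
  qed
  ultimately show ?thesis by blast
qed

lemma in_radius_mono:
  assumes "\<gamma> \<in> ext_values G" "\<delta> \<in> ext_values G" "\<epsilon> \<in> ext_values G"
    and "in_radius k \<gamma> \<delta>" "vle G \<delta> \<epsilon>"
  shows "in_radius k \<gamma> \<epsilon>"
  using assms value_group.vle_trans[of \<gamma> \<delta> \<epsilon>] value_group.vless_vle_trans[of \<gamma> \<delta> \<epsilon>]
  by (cases k) (auto simp: in_radius_def)

lemma in_radius_add:
  assumes "\<gamma> \<in> ext_values G" "a \<in> carrier K" "b \<in> carrier K"
    and "in_radius k \<gamma> (v a)" "in_radius k \<gamma> (v b)"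
  shows "in_radius k \<gamma> (v (a \<oplus> b))"
proof -
  have "in_radius k \<gamma> (vmin G (v a) (v b))" "vmin G (v a) (v b) \<in> ext_values G"
    using assms v_closed by (auto simp: vmin_def)
  then show ?thesis
    using in_radius_mono[OF assms(1) _ v_closed[of "a \<oplus> b"]] v_add[of a b] assms by simp
qed

lemma in_radius_triangle:
  assumes "\<gamma> \<in> ext_values G" "a \<in> carrier K" "b \<in> carrier K" "c \<in> carrier K"
    and "in_radius k \<gamma> (v (a \<ominus> b))" "in_radius k \<gamma> (v (b \<ominus> c))"
  shows "in_radius k \<gamma> (v (a \<ominus> c))"
proof -
  have "a \<ominus> c = (a \<ominus> b) \<oplus> (b \<ominus> c)"
    using assms by (simp add: minus_eq a_ac r_neg1 r_neg2)
  then show ?thesis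
    using in_radius_add[of \<gamma> "a \<ominus> b" "b \<ominus> c" k] assms by simp
qed

lemma center_in_ball:
  assumes "c \<in> carrier K" "\<gamma> \<in> radii k"
  shows "in_radius k \<gamma> (v (c \<ominus> c))"
  using assms v_zero by (cases k) (auto simp: in_radius_def radii_def vless_def minus_eq r_neg)

lemma recenter:
  assumes "\<gamma> \<in> ext_values G" "a \<in> carrier K" "b \<in> carrier K" "in_radius k \<gamma> (v (a \<ominus> b))"
  shows "ball k a \<gamma> = ball k b \<gamma>"
  using assms in_radius_triangle[of \<gamma> _ a b k] in_radius_triangle[of \<gamma> _ b a k] minus_minus_swap[of a b]
  unfolding ball_def by auto

lemma vball_cases:
  assumes "(k, \<gamma>, S) \<in> vballs K G v"
  obtains c where "c \<in> S" "c \<in> carrier K" "\<gamma> \<in> radii k"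
    "S = {a \<in> carrier K. in_radius k \<gamma> (v (a \<ominus> c))}"
  using assms center_in_ball by (auto simp: vballs_eq ball_def)

lemma vball_around:
  assumes "(k, \<gamma>, S) \<in> vballs K G v" "b \<in> S"
  shows "b \<in> carrier K" "\<gamma> \<in> radii k" "(k, \<gamma>, S) = ball k b \<gamma>"
proof -
  obtain c where c: "c \<in> carrier K" "\<gamma> \<in> radii k" "(k, \<gamma>, S) = ball k c \<gamma>"
    using assms(1) by (auto simp: vballs_eq ball_def)
  then show "\<gamma> \<in> radii k" and b: "b \<in> carrier K"
    using assms(2) by (auto simp: ball_def)
  show "(k, \<gamma>, S) = ball k b \<gamma>"
    using c assms(2) recenter[of \<gamma> b c k] b radii_subset by (auto simp: ball_def)
qed

text \<open>
  The ultrametric fact that a ball looks the same from every point outside it: \<open>b\<close> has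
  the same distance to all points of a ball that misses \<open>b\<close>. A point whose distance
  to \<open>b\<close> differs from this one value is therefore outside the ball.
\<close>

lemma outside_ball_distance:
  assumes "\<gamma> \<in> ext_values G" "a \<in> carrier K" "b \<in> carrier K" "c \<in> carrier K"
    and "in_radius k \<gamma> (v (a \<ominus> c))" "\<not> in_radius k \<gamma> (v (b \<ominus> c))"
  shows "v (a \<ominus> b) = v (b \<ominus> c)"
proof -
  let ?d = "v (b \<ominus> c)"
  have E: "v (a \<ominus> c) \<in> ext_values G" "?d \<in> ext_values G" "v (a \<ominus> b) \<in> ext_values G"
    using assms v_closed by auto
  then have far: "vless G ?d (v (a \<ominus> c))"
    using in_radius_mono[of \<gamma> "v (a \<ominus> c)" ?d k] assms value_group.not_vle_iff by blast
  then have 1: "vle G ?d (v (a \<ominus> b))"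
    using in_radius_triangle[of ?d a c b Closed] assms E value_group.vle_refl minus_minus_swap
    by (auto simp: in_radius_def vless_def)
  have "\<not> vless G ?d (v (a \<ominus> b))"
  proof
    assume "vless G ?d (v (a \<ominus> b))"
    then have "vless G ?d (v (b \<ominus> c))"
      using in_radius_triangle[of ?d b a c Open] assms E far minus_minus_swap[of a b]
      by (auto simp: in_radius_def)
    then show False by (simp add: vless_def)
  qed
  with 1 show ?thesis by (auto simp: vless_def)
qed

text \<open>
  An infinite residue field yields infinitely many elements of the unit ball that lie in
  distinct residue classes. Their differences are units, and scaling and translating them
  gives infinitely many points with pairwise distance \<open>g\<close> in the closed ball of
  radius \<open>g\<close> around \<open>c\<close>.
\<close>

lemma infinite_equidistant:
  assumes "infinite (carrier (residue_field K G v))" "g \<in> carrier G" "c \<in> carrier K"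
  shows "\<exists>E \<subseteq> carrier K. infinite E \<and> (\<forall>a\<in>E. vle G (Val g) (v (a \<ominus> c))) \<and>
    (\<forall>a\<in>E. \<forall>b\<in>E. a \<noteq> b \<longrightarrow> v (a \<ominus> b) = Val g)"
proof -
  let ?O = "valuation_ring K G v" and ?I = "valuation_ideal K G v"
  let ?C = "carrier (residue_field K G v)"
  have one: "Val \<one>\<^bsub>G\<^esub> \<in> ext_values G"
    by (simp add: ext_values_def)
  have "\<exists>r. r \<in> carrier ?O \<and> C = (\<Union>h\<in>?I. {h \<oplus> r})" if "C \<in> ?C" for C
    using that
    by (auto simp: residue_field_def FactRing_def A_RCOSETS_def' a_r_coset_def' valuation_ring_def)
  then obtain r where r: "\<And>C. C \<in> ?C \<Longrightarrow> r C \<in> carrier ?O"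
      "\<And>C. C \<in> ?C \<Longrightarrow> C = (\<Union>h\<in>?I. {h \<oplus> r C})"
    by metis
  have rK: "r C \<in> carrier K" "vle G (Val \<one>\<^bsub>G\<^esub>) (v (r C))" if "C \<in> ?C" for C
    using r(1)[OF that] by (auto simp: valuation_ring_def)
  have subset: "C \<subseteq> D" if CD: "C \<in> ?C" "D \<in> ?C" and I: "r C \<ominus> r D \<in> ?I" for C D
  proof
    fix x assume "x \<in> C"
    then obtain h where h: "h \<in> ?I" "x = h \<oplus> r C"
      using r(2)[OF CD(1)] by blast
    then have hK: "h \<in> carrier K" by (simp add: valuation_ideal_def)
    then have "x = (h \<oplus> (r C \<ominus> r D)) \<oplus> r D"
      using h rK CD by (simp add: minus_eq a_assoc l_neg)
    moreover have "h \<oplus> (r C \<ominus> r D) \<in> ?I"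
      using in_radius_add[of "Val \<one>\<^bsub>G\<^esub>" h "r C \<ominus> r D" Open] h I hK one
      by (auto simp: valuation_ideal_def in_radius_def)
    ultimately show "x \<in> D"
      using r(2)[OF CD(2)] by blast
  qed
  have unit_distance: "v (r C \<ominus> r D) = Val \<one>\<^bsub>G\<^esub>" if CD: "C \<in> ?C" "D \<in> ?C" "C \<noteq> D" for C D
  proof -
    have K: "r C \<ominus> r D \<in> carrier K" "r D \<ominus> r C \<in> carrier K"
      using rK CD by auto
    have "r C \<ominus> r D \<notin> ?I"
    proof
      assume *: "r C \<ominus> r D \<in> ?I"
      then have "r D \<ominus> r C \<in> ?I"
        using K rK CD minus_minus_swap[of "r C" "r D"] by (simp add: valuation_ideal_def)
      then show False
        using * subset CD by blast
    qed
    moreover have "vle G (Val \<one>\<^bsub>G\<^esub>) (v (r C \<ominus> r D))"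
      using in_radius_add[of "Val \<one>\<^bsub>G\<^esub>" "r C" "\<ominus> r D" Closed] rK CD one v_uminus
      by (simp add: in_radius_def minus_eq)
    ultimately show ?thesis
      using K by (auto simp: valuation_ideal_def vless_def)
  qed
  obtain t where t: "t \<in> carrier K" "v t = Val g"
    using v_surj[OF assms(2)] .
  define e where "e C = c \<oplus> t \<otimes> r C" for C
  have eK: "e C \<in> carrier K" if "C \<in> ?C" for C
    using that rK t assms by (simp add: e_def)
  have dist: "v (e C \<ominus> e D) = Val g" if CD: "C \<in> ?C" "D \<in> ?C" "C \<noteq> D" for C D
  proof -
    have "e C \<ominus> e D = t \<otimes> (r C \<ominus> r D)"
      using CD rK t assms unfolding e_def by algebra
    then show ?thesis
      using v_mult[of t "r C \<ominus> r D"] t rK CD unit_distance assms by simp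
  qed
  have "inj_on e ?C"
  proof (rule inj_onI, rule ccontr)
    fix C D assume *: "C \<in> ?C" "D \<in> ?C" "e C = e D" "C \<noteq> D"
    then show False
      using dist[of C D] eK v_zero by (simp add: minus_eq r_neg)
  qed
  moreover have "vle G (Val g) (v (e C \<ominus> c))" if "C \<in> ?C" for C
  proof -
    have "e C \<ominus> c = t \<otimes> r C"
      using that rK t assms unfolding e_def by algebra
    then have "v (e C \<ominus> c) = vadd G (Val g) (v (r C))"
      using v_mult[of t "r C"] t rK that by simp
    then show ?thesis
      using rK(2)[OF that] v_closed[OF rK(1)[OF that]] assms
        value_group.gle_mult[of "\<one>\<^bsub>G\<^esub>" _ g] value_group.m_comm
      by (cases "v (r C)") (auto simp: ext_values_def)
  qed
  ultimately show ?thesis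
    using assms eK dist finite_imageD[of e ?C]
    by (intro exI[of _ "e ` ?C"]) auto
qed

end

section \<open>Finite satisfiability of approximation types\<close>

locale nontrivial_type = valued_field K G v
  for K :: "('a, 'n) ring_scheme" (structure)
    and G :: "('g, 'm) ordered_group_scheme"
    and v :: "'a \<Rightarrow> 'g ext_value" +
  fixes A :: "('a, 'g) vball set"
  assumes approximation_type: "approximation_type K G v A"
    and not_trivial: "\<not> trivial_type A"
begin

lemma in_vballs: "B \<in> A \<Longrightarrow> B \<in> vballs K G v"
  using approximation_type by (auto simp: approximation_type_def)

lemma comparable: "\<lbrakk>(k, \<gamma>, S) \<in> A; (k', \<gamma>', S') \<in> A\<rbrakk> \<Longrightarrow> S \<subseteq> S' \<or> S' \<subseteq> S"
  using approximation_type unfolding approximation_type_def by blast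

lemma radius_not_Infty:
  assumes "(k, \<gamma>, S) \<in> A"
  shows "\<gamma> \<in> Val ` carrier G"
proof -
  have \<gamma>: "\<gamma> \<in> radii k"
    using vball_cases[OF in_vballs[OF assms]] by blast
  show ?thesis
  proof (cases k)
    case Closed
    then have "\<gamma> \<in> supp A"
      using assms by (auto simp: supp_def)
    then show ?thesis
      using not_trivial \<gamma> Closed by (auto simp: trivial_type_def radii_def ext_values_def)
  qed (use \<gamma> in \<open>simp add: radii_def\<close>)
qed

text \<open>
  The order of the two kinds of radii behind the closure rules of approximation types: the
  closed ball of a radius contains the open one, which contains all balls of larger radius
  around the same center.
\<close>

lemma ball_downward:
  assumes B: "ball k c \<gamma> \<in> A" and c: "c \<in> carrier K" and \<gamma>': "\<gamma>' \<in> radii k'"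
    and le: "vless G \<gamma>' \<gamma> \<or> \<gamma>' = \<gamma> \<and> (k' = Closed \<or> k' = k)"
  shows "ball k' c \<gamma>' \<in> A"
proof -
  have \<gamma>: "\<gamma> \<in> Val ` carrier G" "\<gamma> \<in> ext_values G"
    using radius_not_Infty[of k \<gamma>] B by (auto simp: ball_def ext_values_def)
  show ?thesis
  proof (cases "\<gamma>' = \<gamma>")
    case True
    have "closed_ball K G v c \<gamma> \<in> A" if "open_ball K G v c \<gamma> \<in> A"
      using approximation_type c \<gamma>(1) that unfolding approximation_type_def by blast
    moreover have "k' = Closed \<or> k' = k"
      using True le by (auto simp: vless_def)
    ultimately show ?thesis
      using B True by (cases k; cases k') (simp_all add: ball_simps)
  next
    case False
    then have less: "vless G \<gamma>' \<gamma>"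
      using le by blast
    then have "\<gamma>' \<in> Val ` carrier G"
      using \<gamma>' by (cases k'; cases \<gamma>'; cases \<gamma>) (auto simp: radii_def vless_def ext_values_def)
    moreover have "closed_ball K G v c \<gamma> \<in> A \<or> open_ball K G v c \<gamma> \<in> A"
      using B by (cases k) (auto simp: ball_simps)
    ultimately have "closed_ball K G v c \<gamma>' \<in> A \<and> open_ball K G v c \<gamma>' \<in> A"
      using approximation_type c \<gamma> less unfolding approximation_type_def by blast
    then show ?thesis
      by (cases k') (auto simp: ball_simps)
  qed
qed

lemma ball_radius_unique:
  assumes "(k, \<gamma>, S) \<in> A" "(k, \<gamma>, T) \<in> A"
  shows "S = T"
proof -
  have *: "S = T" if "(k, \<gamma>, S) \<in> A" "(k, \<gamma>, T) \<in> A" "S \<subseteq> T" for S T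
  proof -
    have V: "(k, \<gamma>, S) \<in> vballs K G v" "(k, \<gamma>, T) \<in> vballs K G v"
      using that in_vballs by auto
    obtain b where "b \<in> S"
      using V(1) by (rule vball_cases)
    then have "(k, \<gamma>, S) = (k, \<gamma>, T)"
      using vball_around(3)[OF V(1), of b] vball_around(3)[OF V(2), of b] that(3) by (metis subsetD)
    then show ?thesis by simp
  qed
  show ?thesis
    using comparable[OF assms] * assms by blast
qed

lemma ball_at_eq: "(k, \<gamma>, S) \<in> A \<Longrightarrow> ball_at A k \<gamma> = S"
  unfolding ball_at_def using ball_radius_unique by (auto intro!: the_equality)

lemma ball_at_empty_iff: "ball_at A k \<gamma> = {} \<longleftrightarrow> (\<forall>S. (k, \<gamma>, S) \<notin> A)"
proof
  assume empty: "ball_at A k \<gamma> = {}"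
  show "\<forall>S. (k, \<gamma>, S) \<notin> A"
  proof (intro allI notI)
    fix S assume S: "(k, \<gamma>, S) \<in> A"
    then have "S = {}"
      using ball_at_eq empty by simp
    then show False
      using vball_cases[OF in_vballs[OF S]] by blast
  qed
qed (simp add: ball_at_def)

lemma finite_subset_has_smallest:
  assumes "finite P" "P \<noteq> {}" "P \<subseteq> A"
  shows "\<exists>k \<gamma> S. (k, \<gamma>, S) \<in> P \<and> (\<forall>k' \<gamma>' S'. (k', \<gamma>', S') \<in> P \<longrightarrow> S \<subseteq> S')"
  using assms
proof (induction rule: finite_ne_induct)
  case (singleton B)
  then show ?case by (cases B) auto
next
  case (insert B P)
  obtain k \<gamma> S where B: "B = (k, \<gamma>, S)"
    by (cases B)
  obtain k' \<gamma>' S' where S': "(k', \<gamma>', S') \<in> P" "\<And>k'' \<gamma>'' S''. (k'', \<gamma>'', S'') \<in> P \<Longrightarrow> S' \<subseteq> S''"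
    using insert by blast
  then have "S \<subseteq> S' \<or> S' \<subseteq> S"
    using insert.prems B comparable[of k \<gamma> S k' \<gamma>' S'] by blast
  then show ?case
  proof
    assume "S \<subseteq> S'"
    then show ?thesis
      using S' B by (intro exI[of _ k] exI[of _ \<gamma>] exI[of _ S]) blast
  next
    assume "S' \<subseteq> S"
    then show ?thesis
      using S' B by (intro exI[of _ k'] exI[of _ \<gamma>'] exI[of _ S']) blast
  qed
qed

text \<open>
  A ball that meets a ball of \<open>A\<close> but is not contained in it must be larger, in the sense
  of the radii and not only of the sets of points, and thus belongs to \<open>A\<close>.
\<close>

lemma ball_through_escaping_point:
  assumes B: "(k, \<gamma>, S) \<in> A" "b \<in> S" and C: "(k', \<gamma>', T) \<in> vballs K G v" "b \<in> T"
    and c: "c \<in> T" "c \<notin> S"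
  shows "(k', \<gamma>', T) \<in> A"
proof -
  note B' = vball_around[OF in_vballs[OF B(1)] B(2)] and C' = vball_around[OF C]
  have cK: "c \<in> carrier K" and near: "in_radius k' \<gamma>' (v (c \<ominus> b))"
    using c C'(3) by (auto simp: ball_def)
  have far: "\<not> in_radius k \<gamma> (v (c \<ominus> b))"
    using c(2) B'(3) cK by (auto simp: ball_def)
  have E: "\<gamma> \<in> ext_values G" "\<gamma>' \<in> ext_values G" "v (c \<ominus> b) \<in> ext_values G"
    using radii_subset B' C' cK v_closed by auto
  have "vless G \<gamma>' \<gamma> \<or> \<gamma>' = \<gamma> \<and> (k' = Closed \<or> k' = k)"
  proof (cases k)
    case Closed
    then have "vless G (v (c \<ominus> b)) \<gamma>"
      using far value_group.not_vle_iff[OF E(1,3)] by (simp add: in_radius_def)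
    moreover have "vle G \<gamma>' (v (c \<ominus> b))"
      using near by (cases k') (auto simp: in_radius_def vless_def)
    ultimately show ?thesis
      using value_group.vle_vless_trans[OF E(2,3,1)] by blast
  next
    case Open
    then have le: "vle G (v (c \<ominus> b)) \<gamma>"
      using far value_group.not_vle_iff[OF E(3,1)] by (auto simp: in_radius_def)
    show ?thesis
    proof (cases k')
      case Closed
      then have "vle G \<gamma>' \<gamma>"
        using near value_group.vle_trans[OF E(2,3,1) _ le] by (simp add: in_radius_def)
      then show ?thesis
        using Closed by (auto simp: vless_def)
    next
      case Open
      then show ?thesis
        using near value_group.vless_vle_trans[OF E(2,3,1) _ le] by (simp add: in_radius_def)
    qed
  qed
  then show ?thesis
    using ball_downward[of k b \<gamma> \<gamma>' k'] B B' C' by simp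
qed

text \<open>
  Since no point lies in all balls of \<open>A\<close>, each of the finitely many balls to be avoided
  has a point that is outside some ball of \<open>A\<close>. The smallest of finitely many balls of \<open>A\<close>
  misses all these points. It cannot meet a ball to be avoided, which would otherwise
  belong to \<open>A\<close>, so any of its points will do.
\<close>

lemma satisfiable_if_no_common_point:
  assumes none: "inter_balls K A = {}"
    and P: "finite P" "P \<subseteq> A" and N: "finite N" "N \<subseteq> vballs K G v - A"
  shows "\<exists>a\<in>carrier K. (\<forall>k \<gamma> S. (k, \<gamma>, S) \<in> P \<longrightarrow> a \<in> S) \<and> (\<forall>k \<gamma> S. (k, \<gamma>, S) \<in> N \<longrightarrow> a \<notin> S)"
proof -
  have "\<exists>c B. B \<in> A \<and> c \<in> snd (snd C) \<and> c \<notin> snd (snd B)" if "C \<in> N" for C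
  proof -
    obtain k \<gamma> S where C: "C = (k, \<gamma>, S)" by (cases C)
    then have "(k, \<gamma>, S) \<in> vballs K G v"
      using that N by blast
    then obtain c where c: "c \<in> S" "c \<in> carrier K"
      by (rule vball_cases)
    then obtain k' \<gamma>' S' where "(k', \<gamma>', S') \<in> A" "c \<notin> S'"
      using none by (auto simp: inter_balls_def)
    then show ?thesis
      using c C by (intro exI[of _ c] exI[of _ "(k', \<gamma>', S')"]) auto
  qed
  then obtain c B where cB: "\<And>C. C \<in> N \<Longrightarrow> B C \<in> A \<and> c C \<in> snd (snd C) \<and> c C \<notin> snd (snd (B C))"
    by metis
  obtain B0 where "B0 \<in> A"
    using none zero_closed by (auto simp: inter_balls_def)
  \<comment> \<open>Adding some ball of the type ensures that there is a smallest one.\<close>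
  let ?P = "insert B0 (P \<union> B ` N)"
  have "finite ?P" "?P \<noteq> {}" "?P \<subseteq> A"
    using P N cB \<open>B0 \<in> A\<close> by auto
  then obtain k \<gamma> S where S: "(k, \<gamma>, S) \<in> ?P" "(k, \<gamma>, S) \<in> A"
      and least: "\<And>k' \<gamma>' S'. (k', \<gamma>', S') \<in> ?P \<Longrightarrow> S \<subseteq> S'"
    using finite_subset_has_smallest[of ?P] by blast
  obtain b where b: "b \<in> S" "b \<in> carrier K"
    using in_vballs[OF S(2)] by (rule vball_cases)
  have "b \<notin> T" if T: "(k', \<gamma>', T) \<in> N" for k' \<gamma>' T
  proof
    assume "b \<in> T"
    obtain k'' \<gamma>'' S'' where B: "B (k', \<gamma>', T) = (k'', \<gamma>'', S'')"
      by (cases "B (k', \<gamma>', T)")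
    then have "S \<subseteq> S''"
      using least T by (metis UnI2 imageI insertI2)
    then have "c (k', \<gamma>', T) \<notin> S" "c (k', \<gamma>', T) \<in> T"
      using cB[OF T] B by auto
    then show False
      using ball_through_escaping_point[OF S(2) b(1) _ \<open>b \<in> T\<close>] T N by blast
  qed
  moreover have "b \<in> S'" if "(k', \<gamma>', S') \<in> P" for k' \<gamma>' S'
    using least[of k' \<gamma>' S'] that b by blast
  ultimately show ?thesis
    using b by blast
qed

text \<open>
  Let \<open>c\<close> be in all balls of \<open>A\<close>. The balls around \<open>c\<close> that belong to \<open>A\<close> are then exactly
  those with radius in the support, an initial segment of the value group. A point is
  found by choosing only its distance \<open>m\<close> to \<open>c\<close>: it has to exceed finitely many radii in
  the support, stay below finitely many radii outside of it, and differ from the distances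
  between \<open>c\<close> and the balls that have to be avoided and do not contain \<open>c\<close>.
\<close>

lemma satisfiable_if_value_extending:
  assumes ext: "value_extending K A"
    and dense: "dense_group G" and nontriv: "carrier G \<noteq> {\<one>\<^bsub>G\<^esub>}"
    and P: "finite P" "P \<subseteq> A" and N: "finite N" "N \<subseteq> vballs K G v - A"
  shows "\<exists>a\<in>carrier K. (\<forall>k \<gamma> S. (k, \<gamma>, S) \<in> P \<longrightarrow> a \<in> S) \<and> (\<forall>k \<gamma> S. (k, \<gamma>, S) \<in> N \<longrightarrow> a \<notin> S)"
proof -
  obtain c where cK: "c \<in> carrier K" and c: "\<And>k \<gamma> S. (k, \<gamma>, S) \<in> A \<Longrightarrow> c \<in> S"
    using ext by (auto simp: value_extending_def inter_balls_def)
  have c_ball: "(k, \<gamma>, S) = ball k c \<gamma>" if "(k, \<gamma>, S) \<in> A" for k \<gamma> S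
    using vball_around(3)[OF in_vballs c] that by blast
  have supp: "ball k c \<gamma> \<in> A \<longleftrightarrow> \<gamma> \<in> supp A" if "\<gamma> \<in> radii k" for k \<gamma>
  proof
    assume "ball k c \<gamma> \<in> A"
    then have "ball Closed c \<gamma> \<in> A"
      using ball_downward[of k c \<gamma> \<gamma> Closed] cK radii_subset that by (simp add: radii_def)
    then show "\<gamma> \<in> supp A"
      by (auto simp: supp_def ball_def)
  next
    assume "\<gamma> \<in> supp A"
    then obtain S T where "(Closed, \<gamma>, S) \<in> A" "(Open, \<gamma>, T) \<in> A"
      using ext ball_at_empty_iff[of Open \<gamma>] by (auto simp: value_extending_def supp_def)
    then show "ball k c \<gamma> \<in> A"
      using c_ball by (cases k) metis+
  qed
  define Lo where "Lo = (\<lambda>(k, \<gamma>, S). \<gamma>) ` P"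
  define Hi where "Hi = (\<lambda>(k, \<gamma>, S). \<gamma>) ` {B \<in> N. c \<in> snd (snd B)}"
  \<comment> \<open>Only balls without c matter here; for them the choice of the point is irrelevant.\<close>
  define D where "D = (\<lambda>B. v (c \<ominus> (SOME d. d \<in> snd (snd B)))) ` N"
  have Lo: "finite Lo" "Lo \<subseteq> Val ` carrier G" "Lo \<subseteq> supp A"
  proof -
    show "finite Lo"
      using P by (simp add: Lo_def)
    have "\<gamma> \<in> Val ` carrier G \<and> \<gamma> \<in> supp A" if "\<gamma> \<in> Lo" for \<gamma>
    proof -
      obtain k S where S: "(k, \<gamma>, S) \<in> A"
        using \<open>\<gamma> \<in> Lo\<close> P by (auto simp: Lo_def)
      then show ?thesis
        using supp c_ball[OF S] radius_not_Infty[OF S] vball_around(2)[OF in_vballs[OF S] c[OF S]]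
        by metis
    qed
    then show "Lo \<subseteq> Val ` carrier G" "Lo \<subseteq> supp A" by auto
  qed
  have Hi: "finite Hi" "Hi \<subseteq> ext_values G" "Hi \<inter> supp A = {}"
  proof -
    show "finite Hi"
      using N by (simp add: Hi_def)
    have "\<gamma> \<in> ext_values G \<and> \<gamma> \<notin> supp A" if "\<gamma> \<in> Hi" for \<gamma>
    proof -
      obtain k S where S: "(k, \<gamma>, S) \<in> N" "c \<in> S"
        using \<open>\<gamma> \<in> Hi\<close> by (auto simp: Hi_def)
      then have V: "(k, \<gamma>, S) \<in> vballs K G v" "(k, \<gamma>, S) \<notin> A"
        using N by auto
      show ?thesis
        using supp vball_around[OF V(1) S(2)] V(2) radii_subset by metis
    qed
    then show "Hi \<subseteq> ext_values G" "Hi \<inter> supp A = {}" by auto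
  qed
  have "vless G l h" if lh: "l \<in> Lo" "h \<in> Hi" for l h
  proof (rule ccontr)
    assume "\<not> vless G l h"
    have E: "l \<in> ext_values G" "h \<in> ext_values G" "l \<in> radii Closed" "h \<in> radii Closed"
      using Lo Hi lh by (auto simp: radii_def ext_values_def)
    then have "vless G h l"
      using \<open>\<not> vless G l h\<close> value_group.not_vle_iff[of h l] lh Lo Hi by (auto simp: vless_def)
    moreover have "ball Closed c l \<in> A"
      using supp E lh Lo by blast
    ultimately have "ball Closed c h \<in> A"
      using ball_downward cK E by blast
    then show False
      using supp E lh Hi by blast
  qed
  then obtain m where m: "m \<in> carrier G" "\<forall>l\<in>Lo. vless G l (Val m)" "\<forall>h\<in>Hi. vless G (Val m) h"
      "Val m \<notin> D"
    using value_group.between_avoiding[OF dense nontriv Lo(1,2) Hi(1,2), of D] N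
    by (auto simp: D_def)
  obtain t where t: "t \<in> carrier K" "v t = Val m"
    using v_surj[OF m(1)] .
  define a where "a = t \<oplus> c"
  have a: "a \<in> carrier K" "v (a \<ominus> c) = Val m"
    using t cK by (simp_all add: a_def minus_eq a_assoc r_neg)
  have mE: "Val m \<in> ext_values G"
    using m by (simp add: ext_values_def)
  have "a \<in> S" if S: "(k, \<gamma>, S) \<in> P" for k \<gamma> S
  proof -
    have "\<gamma> \<in> Lo"
      using S by (force simp: Lo_def)
    then have "in_radius k \<gamma> (Val m)"
      using m(2) by (cases k) (auto simp: in_radius_def vless_def)
    moreover have "(k, \<gamma>, S) = ball k c \<gamma>"
      using c_ball S P by blast
    ultimately show ?thesis
      using a by (auto simp: ball_def)
  qed
  moreover have "a \<notin> S" if S: "(k, \<gamma>, S) \<in> N" for k \<gamma> S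
  proof
    assume "a \<in> S"
    have V: "(k, \<gamma>, S) \<in> vballs K G v"
      using S N by blast
    show False
    proof (cases "c \<in> S")
      case True
      note V' = vball_around[OF V True]
      have "\<gamma> \<in> Hi"
        using S True by (force simp: Hi_def)
      then have "vless G (Val m) \<gamma>" and E: "\<gamma> \<in> ext_values G"
        using m Hi by auto
      moreover have "in_radius k \<gamma> (Val m)"
        using \<open>a \<in> S\<close> V'(3) a by (simp add: ball_def)
      ultimately show False
        using value_group.not_vle_iff[OF E mE] by (cases k) (auto simp: in_radius_def vless_def)
    next
      case False
      define d where "d = (SOME d. d \<in> S)"
      have "d \<in> S"
        unfolding d_def by (rule someI[of _ a]) fact
      note V' = vball_around[OF V this]
      have "v (a \<ominus> c) = v (c \<ominus> d)"
        using V'(1,2,3) radii_subset a cK \<open>a \<in> S\<close> False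
        by (intro outside_ball_distance[of \<gamma> a c d k]) (auto simp: ball_def)
      moreover have "v (c \<ominus> d) \<in> D"
        using S by (force simp: D_def d_def)
      ultimately show False
        using a m by simp
    qed
  qed
  ultimately show ?thesis
    using a by blast
qed

text \<open>
  The failure of being value-extending is witnessed by a radius whose closed ball belongs
  to the type while its open ball does not. By downward closure nothing smaller can belong
  to the type.
\<close>

lemma smallest_closed_ball:
  assumes "inter_balls K A \<noteq> {}" "\<not> value_extending K A"
  obtains c g where "g \<in> carrier G" "c \<in> carrier K" "ball Closed c (Val g) \<in> A"
    "\<And>S. (Open, Val g, S) \<notin> A" "\<And>k \<gamma> S. (k, \<gamma>, S) \<in> A \<Longrightarrow> c \<in> S"
proof -
  obtain c where cK: "c \<in> carrier K" and c: "\<And>k \<gamma> S. (k, \<gamma>, S) \<in> A \<Longrightarrow> c \<in> S"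
    using assms by (auto simp: inter_balls_def)
  obtain \<gamma> S where S: "(Closed, \<gamma>, S) \<in> A" "\<And>T. (Open, \<gamma>, T) \<notin> A"
    using assms not_trivial ball_at_empty_iff[of Open] by (auto simp: value_extending_def supp_def)
  obtain g where "g \<in> carrier G" "\<gamma> = Val g"
    using radius_not_Infty[OF S(1)] by blast
  moreover have "(Closed, \<gamma>, S) = ball Closed c \<gamma>"
    using vball_around(3)[OF in_vballs[OF S(1)] c[OF S(1)]] .
  ultimately show thesis
    using that[of g c] S cK c by metis
qed

text \<open>
  A point outside the smallest ball, at distance \<open>\<delta>\<close> from it, lies in the closed but not in
  the open ball of \<open>A\<close> of radius \<open>\<delta>\<close>. The points of the smallest ball lie in the closed
  ball of radius \<open>g\<close>, and \<open>A\<close> has no open ball of this radius.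
\<close>

lemma residue_extending_if_smallest_ball:
  assumes "inter_balls K A \<noteq> {}" "\<not> value_extending K A"
  shows "residue_extending K A"
proof -
  obtain c g where g: "g \<in> carrier G" and c: "c \<in> carrier K" and B: "ball Closed c (Val g) \<in> A"
      and no_open: "\<And>S. (Open, Val g, S) \<notin> A"
    using smallest_closed_ball[OF assms] by metis
  have "\<exists>\<gamma>\<in>supp A. d \<in> ball_at A Closed \<gamma> - ball_at A Open \<gamma>" if d: "d \<in> carrier K" for d
  proof (cases "vle G (Val g) (v (d \<ominus> c))")
    case True
    have "Val g \<in> supp A"
      using B by (auto simp: supp_def ball_def)
    moreover have "d \<in> ball_at A Closed (Val g)"
      using ball_at_eq B d True by (auto simp: ball_def in_radius_def)
    moreover have "ball_at A Open (Val g) = {}"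
      using no_open ball_at_empty_iff by blast
    ultimately show ?thesis by blast
  next
    case False
    let ?d = "v (d \<ominus> c)"
    have E: "?d \<in> ext_values G"
      using d c v_closed by simp
    then have less: "vless G ?d (Val g)"
      using value_group.not_vle_iff[of "Val g" ?d] False g by (simp add: ext_values_def)
    then have "?d \<in> Val ` carrier G"
      using E by (auto simp: ext_values_def vless_def)
    then have balls: "ball Closed c ?d \<in> A" "ball Open c ?d \<in> A"
      using ball_downward[OF B c] less E by (auto simp: radii_def)
    then have "?d \<in> supp A"
      by (auto simp: supp_def ball_def)
    moreover have "d \<in> ball_at A Closed ?d"
      using ball_at_eq balls(1) d value_group.vle_refl[OF E] by (auto simp: ball_def in_radius_def)
    moreover have "d \<notin> ball_at A Open ?d"
      using ball_at_eq balls(2) by (auto simp: ball_def in_radius_def vless_def)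
    ultimately show ?thesis by blast
  qed
  then show ?thesis
    using assms not_trivial by (auto simp: residue_extending_def)
qed

text \<open>
  The smallest ball \<open>B\<close> of \<open>A\<close> contains infinitely many points whose pairwise distance is
  its radius. A ball that does not belong to \<open>A\<close> contains at most one of them: with two, its
  radius could not exceed that of \<open>B\<close>, and it would belong to \<open>A\<close>. Hence all but finitely many of these points satisfy the
  conditions.
\<close>

lemma satisfiable_if_smallest_ball:
  assumes "inter_balls K A \<noteq> {}" "\<not> value_extending K A"
    and inf: "infinite (carrier (residue_field K G v))"
    and P: "finite P" "P \<subseteq> A" and N: "finite N" "N \<subseteq> vballs K G v - A"
  shows "\<exists>a\<in>carrier K. (\<forall>k \<gamma> S. (k, \<gamma>, S) \<in> P \<longrightarrow> a \<in> S) \<and> (\<forall>k \<gamma> S. (k, \<gamma>, S) \<in> N \<longrightarrow> a \<notin> S)"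
proof -
  obtain c g where g: "g \<in> carrier G" and cK: "c \<in> carrier K" and B: "ball Closed c (Val g) \<in> A"
      and no_open: "\<And>S. (Open, Val g, S) \<notin> A" and c: "\<And>k \<gamma> S. (k, \<gamma>, S) \<in> A \<Longrightarrow> c \<in> S"
    using smallest_closed_ball[OF assms(1,2)] by metis
  have gE: "Val g \<in> ext_values G"
    using g by (simp add: ext_values_def)
  obtain E where E: "E \<subseteq> carrier K" "infinite E" "\<And>a. a \<in> E \<Longrightarrow> vle G (Val g) (v (a \<ominus> c))"
      "\<And>a b. a \<in> E \<Longrightarrow> b \<in> E \<Longrightarrow> a \<noteq> b \<Longrightarrow> v (a \<ominus> b) = Val g"
    using infinite_equidistant[OF inf g cK] by blast
  have *: "a = b" if S: "(k, \<gamma>, S) \<in> N" and ab: "a \<in> E \<inter> S" "b \<in> E \<inter> S" for k \<gamma> S a b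
  proof (rule ccontr)
    assume "a \<noteq> b"
    have V: "(k, \<gamma>, S) \<in> vballs K G v"
      using S N by blast
    note V' = vball_around[OF V, of b]
    have "in_radius k \<gamma> (Val g)"
      using V'(3) ab E(4)[of a b] \<open>a \<noteq> b\<close> by (auto simp: ball_def)
    then have "vless G \<gamma> (Val g) \<or> \<gamma> = Val g \<and> (k = Closed \<or> k = Closed)"
      by (cases k) (auto simp: in_radius_def vless_def)
    moreover have "ball Closed b (Val g) \<in> A"
      using recenter[of "Val g" b c Closed] B E ab cK gE by (auto simp: in_radius_def)
    ultimately have "ball k b \<gamma> \<in> A"
      using ball_downward[of Closed b "Val g" \<gamma> k] V' ab by blast
    then show False
      using V'(3) ab S N by auto
  qed
  then have "finite (E \<inter> S)" if "(k, \<gamma>, S) \<in> N" for k \<gamma> S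
  proof (cases "E \<inter> S = {}")
    case False
    then obtain b where "b \<in> E \<inter> S" by blast
    then have "E \<inter> S \<subseteq> {b}"
      using *[OF that] by blast
    then show ?thesis
      using finite_subset by blast
  qed simp
  then have "finite (\<Union>B\<in>N. E \<inter> snd (snd B))"
    using N by (intro finite_UN_I) auto
  then obtain a where a: "a \<in> E" "a \<notin> (\<Union>B\<in>N. E \<inter> snd (snd B))"
    using E(2) by (meson finite_subset subsetI)
  have "a \<in> S" if S: "(k, \<gamma>, S) \<in> P" for k \<gamma> S
  proof -
    have SA: "(k, \<gamma>, S) \<in> A"
      using S P by blast
    note V' = vball_around[OF in_vballs[OF SA] c[OF SA]]
    have \<gamma>E: "\<gamma> \<in> ext_values G"
      using V' radii_subset by blast
    have op: "ball Open c (Val g) \<notin> A"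
      using no_open by (auto simp: ball_def)
    have gr: "Val g \<in> radii Open"
      using g by (simp add: radii_def)
    have "\<not> vless G (Val g) \<gamma>" "\<not> (\<gamma> = Val g \<and> k = Open)"
      using ball_downward[of k c \<gamma> "Val g" Open] V' SA cK op gr by auto
    then have "in_radius k \<gamma> (Val g)"
      using value_group.not_vle_iff[OF \<gamma>E gE]
      by (cases k) (auto simp: in_radius_def vless_def)
    then have "in_radius k \<gamma> (v (a \<ominus> c))"
      using in_radius_mono[OF \<gamma>E gE v_closed] E(1,3) a cK by auto
    then show ?thesis
      using V'(3) E(1) a by (auto simp: ball_def)
  qed
  moreover have "a \<notin> S" if "(k, \<gamma>, S) \<in> N" for k \<gamma> S
    using a that by force
  ultimately show ?thesis
    using a E(1) by blast
qed

end

section \<open>Classes modulo an ultrafilter\<close>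

text \<open>
  Classes are taken within the functions into a given carrier, so that the values of a
  function outside of it never matter.
\<close>

definition ultra_class :: "'i filter \<Rightarrow> 'b set \<Rightarrow> ('i \<Rightarrow> 'b) \<Rightarrow> ('i \<Rightarrow> 'b) set" where
  "ultra_class U B f = {g. (\<forall>i. g i \<in> B) \<and> (\<forall>\<^sub>F i in U. g i = f i)}"

definition ultra_carrier :: "'i filter \<Rightarrow> 'b set \<Rightarrow> ('i \<Rightarrow> 'b) set set" where
  "ultra_carrier U B = ultra_class U B ` {f. \<forall>i. f i \<in> B}"

definition representative :: "('i \<Rightarrow> 'b) set \<Rightarrow> 'i \<Rightarrow> 'b" where
  "representative Z = (SOME f. f \<in> Z)"

definition ultra_field :: "'i filter \<Rightarrow> ('a, 'n) ring_scheme \<Rightarrow> ('i \<Rightarrow> 'a) set ring" where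
  "ultra_field U K =
    \<lparr>carrier = ultra_carrier U (carrier K),
     monoid.mult = \<lambda>Y Z. ultra_class U (carrier K) (\<lambda>i. representative Y i \<otimes>\<^bsub>K\<^esub> representative Z i),
     one = ultra_class U (carrier K) (\<lambda>i. \<one>\<^bsub>K\<^esub>),
     ring.zero = ultra_class U (carrier K) (\<lambda>i. \<zero>\<^bsub>K\<^esub>),
     ring.add = \<lambda>Y Z. ultra_class U (carrier K) (\<lambda>i. representative Y i \<oplus>\<^bsub>K\<^esub> representative Z i)\<rparr>"

definition ultra_group ::
  "'i filter \<Rightarrow> ('g, 'm) ordered_group_scheme \<Rightarrow> ('i \<Rightarrow> 'g) set ordered_group" where
  "ultra_group U G =
    \<lparr>carrier = ultra_carrier U (carrier G),
     monoid.mult = \<lambda>Y Z. ultra_class U (carrier G) (\<lambda>i. representative Y i \<otimes>\<^bsub>G\<^esub> representative Z i),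
     one = ultra_class U (carrier G) (\<lambda>i. \<one>\<^bsub>G\<^esub>),
     gle = \<lambda>Y Z. \<forall>\<^sub>F i in U. representative Y i \<preceq>\<^bsub>G\<^esub> representative Z i\<rparr>"

text \<open>
  The limit of a family of values. The value \<open>\<infinity>\<close> is not an element of the value group
  and has to be treated as a limit of its own; if almost no value is infinite, the
  infinite ones are replaced by an arbitrary element of the group.
\<close>

definition ultra_value ::
  "'i filter \<Rightarrow> ('g, 'm) ordered_group_scheme \<Rightarrow> ('i \<Rightarrow> 'g ext_value) \<Rightarrow> ('i \<Rightarrow> 'g) set ext_value" where
  "ultra_value U G h =
    (if \<forall>\<^sub>F i in U. h i = Infty then Infty
     else Val (ultra_class U (carrier G) (\<lambda>i. case h i of Val g \<Rightarrow> g | Infty \<Rightarrow> \<one>\<^bsub>G\<^esub>)))"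

definition ultra_valuation ::
  "'i filter \<Rightarrow> ('g, 'm) ordered_group_scheme \<Rightarrow> ('a \<Rightarrow> 'g ext_value) \<Rightarrow>
    ('i \<Rightarrow> 'a) set \<Rightarrow> ('i \<Rightarrow> 'g) set ext_value" where
  "ultra_valuation U G v Z = ultra_value U G (\<lambda>i. v (representative Z i))"

context ultrafilter
begin

lemma representative_class:
  assumes "\<forall>i. f i \<in> B"
  shows "\<forall>i. representative (ultra_class U B f) i \<in> B"
    and "\<forall>\<^sub>F i in U. representative (ultra_class U B f) i = f i"
proof -
  have "f \<in> ultra_class U B f"
    using assms by (simp add: ultra_class_def)
  then have "representative (ultra_class U B f) \<in> ultra_class U B f"
    unfolding representative_def by (rule someI[where P = "\<lambda>h. h \<in> ultra_class U B f"])
  then show "\<forall>i. representative (ultra_class U B f) i \<in> B"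
    and "\<forall>\<^sub>F i in U. representative (ultra_class U B f) i = f i"
    by (simp_all add: ultra_class_def)
qed

lemma class_eqI:
  assumes "\<forall>\<^sub>F i in U. f i = g i"
  shows "ultra_class U B f = ultra_class U B g"
proof -
  have "(\<forall>\<^sub>F i in U. h i = f i) \<longleftrightarrow> (\<forall>\<^sub>F i in U. h i = g i)" for h
    by (rule eventually_cong[OF assms]) simp
  then show ?thesis
    by (simp add: ultra_class_def)
qed

lemma class_eq_iff:
  assumes "\<forall>i. f i \<in> B" "\<forall>i. g i \<in> B"
  shows "ultra_class U B f = ultra_class U B g \<longleftrightarrow> (\<forall>\<^sub>F i in U. f i = g i)"
proof
  assume "ultra_class U B f = ultra_class U B g"
  then have "f \<in> ultra_class U B g"
    using assms by (auto simp: ultra_class_def)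
  then show "\<forall>\<^sub>F i in U. f i = g i"
    by (simp add: ultra_class_def)
qed (rule class_eqI)

lemma class_in_carrier: "\<forall>i. f i \<in> B \<Longrightarrow> ultra_class U B f \<in> ultra_carrier U B"
  by (auto simp: ultra_carrier_def)

lemma ultra_carrierE:
  assumes "Z \<in> ultra_carrier U B"
  obtains f where "\<forall>i. f i \<in> B" "Z = ultra_class U B f"
  using assms by (auto simp: ultra_carrier_def)

text \<open>
  Every operation on the factors induces one on the classes. Working with chosen
  representatives is harmless since they agree with the given functions almost everywhere.
\<close>

lemma class_of_representatives:
  assumes "\<forall>i. f i \<in> B" "\<forall>i. g i \<in> B"
  shows "ultra_class U C (\<lambda>i. op (representative (ultra_class U B f) i) (representative (ultra_class U B g) i))
    = ultra_class U C (\<lambda>i. op (f i) (g i))"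
proof (rule class_eqI)
  show "\<forall>\<^sub>F i in U. op (representative (ultra_class U B f) i) (representative (ultra_class U B g) i)
      = op (f i) (g i)"
    using representative_class(2)[OF assms(1)] representative_class(2)[OF assms(2)]
    by eventually_elim simp
qed

end

section \<open>Operations and values in an ultrapower\<close>

locale ultrapower = valued_field K G v + ultrafilter U
  for K :: "('a, 'n) ring_scheme" (structure)
    and G :: "('g, 'm) ordered_group_scheme"
    and v :: "'a \<Rightarrow> 'g ext_value"
    and U :: "'i filter"
begin

abbreviation L where "L \<equiv> ultra_field U K"
abbreviation H where "H \<equiv> ultra_group U G"
abbreviation w where "w \<equiv> ultra_valuation U G v"
abbreviation elem where "elem \<equiv> ultra_class U (carrier K)"
abbreviation gamma where "gamma \<equiv> ultra_class U (carrier G)"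

lemma L_simps:
  "carrier L = ultra_carrier U (carrier K)"
  "\<one>\<^bsub>L\<^esub> = elem (\<lambda>i. \<one>)"
  "\<zero>\<^bsub>L\<^esub> = elem (\<lambda>i. \<zero>)"
  by (simp_all add: ultra_field_def)

lemma H_simps:
  "carrier H = ultra_carrier U (carrier G)"
  "\<one>\<^bsub>H\<^esub> = gamma (\<lambda>i. \<one>\<^bsub>G\<^esub>)"
  by (simp_all add: ultra_group_def)

lemma elem_mult:
  "\<lbrakk>\<forall>i. f i \<in> carrier K; \<forall>i. g i \<in> carrier K\<rbrakk> \<Longrightarrow> elem f \<otimes>\<^bsub>L\<^esub> elem g = elem (\<lambda>i. f i \<otimes> g i)"
  by (simp add: ultra_field_def class_of_representatives)

lemma elem_add:
  "\<lbrakk>\<forall>i. f i \<in> carrier K; \<forall>i. g i \<in> carrier K\<rbrakk> \<Longrightarrow> elem f \<oplus>\<^bsub>L\<^esub> elem g = elem (\<lambda>i. f i \<oplus> g i)"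
  by (simp add: ultra_field_def class_of_representatives)

lemma gamma_mult:
  "\<lbrakk>\<forall>i. f i \<in> carrier G; \<forall>i. g i \<in> carrier G\<rbrakk>
    \<Longrightarrow> gamma f \<otimes>\<^bsub>H\<^esub> gamma g = gamma (\<lambda>i. f i \<otimes>\<^bsub>G\<^esub> g i)"
  by (simp add: ultra_group_def class_of_representatives)

lemma gamma_le:
  assumes "\<forall>i. f i \<in> carrier G" "\<forall>i. g i \<in> carrier G"
  shows "gamma f \<preceq>\<^bsub>H\<^esub> gamma g \<longleftrightarrow> (\<forall>\<^sub>F i in U. f i \<preceq>\<^bsub>G\<^esub> g i)"
proof -
  have "\<forall>\<^sub>F i in U. (representative (gamma f) i \<preceq>\<^bsub>G\<^esub> representative (gamma g) i)
      = (f i \<preceq>\<^bsub>G\<^esub> g i)"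
    using representative_class(2)[OF assms(1)] representative_class(2)[OF assms(2)]
    by eventually_elim simp
  then show ?thesis
    by (simp add: ultra_group_def eventually_subst)
qed

lemma carrier_L_E:
  assumes "Z \<in> carrier L"
  obtains f where "\<forall>i. f i \<in> carrier K" "Z = elem f"
  using assms unfolding L_simps by (rule ultra_carrierE)

lemma carrier_H_E:
  assumes "Z \<in> carrier H"
  obtains f where "\<forall>i. f i \<in> carrier G" "Z = gamma f"
  using assms unfolding H_simps by (rule ultra_carrierE)

lemma elem_in_L: "\<forall>i. f i \<in> carrier K \<Longrightarrow> elem f \<in> carrier L"
  by (simp add: L_simps class_in_carrier)

lemma gamma_in_H: "\<forall>i. f i \<in> carrier G \<Longrightarrow> gamma f \<in> carrier H"
  by (simp add: H_simps class_in_carrier)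

lemma ordered_ab_group_H: "ordered_ab_group H"
proof -
  have "comm_group H"
  proof (rule comm_groupI)
    fix x assume "x \<in> carrier H"
    then obtain f where f: "\<forall>i. f i \<in> carrier G" "x = gamma f"
      by (auto elim!: carrier_H_E)
    then have "gamma (\<lambda>i. inv\<^bsub>G\<^esub> f i) \<otimes>\<^bsub>H\<^esub> x = \<one>\<^bsub>H\<^esub>"
      by (simp add: gamma_mult H_simps)
    moreover have "gamma (\<lambda>i. inv\<^bsub>G\<^esub> f i) \<in> carrier H"
      using f by (intro gamma_in_H) simp
    ultimately show "\<exists>y\<in>carrier H. y \<otimes>\<^bsub>H\<^esub> x = \<one>\<^bsub>H\<^esub>"
      by blast
  qed (auto elim!: carrier_H_E simp: gamma_mult value_group.m_ac H_simps(2) intro!: gamma_in_H)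
  then interpret H: comm_group H .
  show ?thesis
  proof
    fix a b assume ab: "a \<in> carrier H" "b \<in> carrier H"
    then obtain f g where fg: "\<forall>i. f i \<in> carrier G" "a = gamma f" "\<forall>i. g i \<in> carrier G" "b = gamma g"
      by (auto elim!: carrier_H_E)
    show "a \<preceq>\<^bsub>H\<^esub> a"
      using fg by (simp add: gamma_le value_group.gle_refl)
    show "a \<preceq>\<^bsub>H\<^esub> b \<or> b \<preceq>\<^bsub>H\<^esub> a"
      using fg by (simp add: gamma_le eventually_disj_iff[symmetric] value_group.gle_total)
    show "a = b" if "a \<preceq>\<^bsub>H\<^esub> b" "b \<preceq>\<^bsub>H\<^esub> a"
    proof -
      have "\<forall>\<^sub>F i in U. f i \<preceq>\<^bsub>G\<^esub> g i" "\<forall>\<^sub>F i in U. g i \<preceq>\<^bsub>G\<^esub> f i"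
        using that fg by (simp_all add: gamma_le)
      then have "\<forall>\<^sub>F i in U. f i = g i"
        by eventually_elim (use fg in \<open>simp add: value_group.gle_antisym\<close>)
      then show ?thesis
        using fg class_eqI by blast
    qed
    fix c assume "c \<in> carrier H"
    then obtain h where h: "\<forall>i. h i \<in> carrier G" "c = gamma h"
      by (auto elim!: carrier_H_E)
    show "a \<preceq>\<^bsub>H\<^esub> c" if "a \<preceq>\<^bsub>H\<^esub> b" "b \<preceq>\<^bsub>H\<^esub> c"
    proof -
      have "\<forall>\<^sub>F i in U. f i \<preceq>\<^bsub>G\<^esub> g i" "\<forall>\<^sub>F i in U. g i \<preceq>\<^bsub>G\<^esub> h i"
        using that fg h by (simp_all add: gamma_le)
      then have "\<forall>\<^sub>F i in U. f i \<preceq>\<^bsub>G\<^esub> h i"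
        by eventually_elim (use fg h value_group.gle_trans in blast)
      then show ?thesis
        using fg h by (simp add: gamma_le)
    qed
    show "a \<otimes>\<^bsub>H\<^esub> c \<preceq>\<^bsub>H\<^esub> b \<otimes>\<^bsub>H\<^esub> c" if "a \<preceq>\<^bsub>H\<^esub> b"
    proof -
      have "\<forall>\<^sub>F i in U. f i \<preceq>\<^bsub>G\<^esub> g i"
        using that fg by (simp add: gamma_le)
      then have "\<forall>\<^sub>F i in U. f i \<otimes>\<^bsub>G\<^esub> h i \<preceq>\<^bsub>G\<^esub> g i \<otimes>\<^bsub>G\<^esub> h i"
        by eventually_elim (use fg h in \<open>simp add: value_group.gle_mult\<close>)
      then show ?thesis
        using fg h by (simp add: gamma_le gamma_mult)
    qed
  qed
qed

lemma field_L: "field L"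
proof -
  have "abelian_group L"
  proof (rule abelian_groupI)
    fix x assume "x \<in> carrier L"
    then obtain f where f: "\<forall>i. f i \<in> carrier K" "x = elem f"
      by (auto elim!: carrier_L_E)
    then have "elem (\<lambda>i. \<ominus> f i) \<oplus>\<^bsub>L\<^esub> x = \<zero>\<^bsub>L\<^esub>"
      by (simp add: elem_add L_simps l_neg)
    moreover have "elem (\<lambda>i. \<ominus> f i) \<in> carrier L"
      using f by (intro elem_in_L) simp
    ultimately show "\<exists>y\<in>carrier L. y \<oplus>\<^bsub>L\<^esub> x = \<zero>\<^bsub>L\<^esub>"
      by blast
  qed (auto elim!: carrier_L_E simp: elem_add a_ac L_simps(3) intro!: elem_in_L)
  moreover have "comm_monoid L"
    by (rule comm_monoidI)
      (auto elim!: carrier_L_E simp: elem_mult m_ac L_simps(2) intro!: elem_in_L)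
  ultimately have "cring L"
    by (rule cringI) (auto elim!: carrier_L_E simp: elem_mult elem_add l_distr)
  then show ?thesis
  proof (rule cring.cring_fieldI2)
    show "\<zero>\<^bsub>L\<^esub> \<noteq> \<one>\<^bsub>L\<^esub>"
      by (simp add: L_simps class_eq_iff eventually_const_iff)
    fix a assume "a \<in> carrier L" "a \<noteq> \<zero>\<^bsub>L\<^esub>"
    then obtain f where f: "\<forall>i. f i \<in> carrier K" "a = elem f"
      by (auto elim!: carrier_L_E)
    then have nz: "\<not> (\<forall>\<^sub>F i in U. f i = \<zero>)"
      using \<open>a \<noteq> \<zero>\<^bsub>L\<^esub>\<close> class_eqI[of f "\<lambda>i. \<zero>"] by (auto simp: L_simps(3))
    define g where "g i = (if f i = \<zero> then \<zero> else inv f i)" for i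
    have g: "\<forall>i. g i \<in> carrier K"
      using f by (auto simp: g_def field_Units)
    have "\<forall>\<^sub>F i in U. f i \<noteq> \<zero>"
      using nz by (simp add: eventually_not_iff)
    then have "\<forall>\<^sub>F i in U. f i \<otimes> g i = \<one>"
      by eventually_elim (use f in \<open>simp add: g_def field_Units\<close>)
    then have "a \<otimes>\<^bsub>L\<^esub> elem g = \<one>\<^bsub>L\<^esub>"
      using f g by (simp add: elem_mult L_simps class_eq_iff)
    then show "\<exists>b\<in>carrier L. a \<otimes>\<^bsub>L\<^esub> b = \<one>\<^bsub>L\<^esub>"
      using elem_in_L[OF g] by blast
  qed
qed

sublocale L: field L
  by (rule field_L)

sublocale H: ordered_ab_group H
  by (rule ordered_ab_group_H)

lemma elem_uminus:
  assumes f: "\<forall>i. f i \<in> carrier K"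
  shows "\<ominus>\<^bsub>L\<^esub> elem f = elem (\<lambda>i. \<ominus> f i)"
proof -
  have "elem (\<lambda>i. \<ominus> f i) \<oplus>\<^bsub>L\<^esub> elem f = \<zero>\<^bsub>L\<^esub>"
    using f by (simp add: elem_add L_simps l_neg)
  moreover have "elem (\<lambda>i. \<ominus> f i) \<in> carrier L"
    using f by (intro elem_in_L) simp
  ultimately show ?thesis
    using L.minus_equality elem_in_L[OF f] by blast
qed

lemma elem_minus:
  "\<lbrakk>\<forall>i. f i \<in> carrier K; \<forall>i. g i \<in> carrier K\<rbrakk> \<Longrightarrow> elem f \<ominus>\<^bsub>L\<^esub> elem g = elem (\<lambda>i. f i \<ominus> g i)"
  by (simp add: a_minus_def elem_uminus elem_add)

lemma elem_pow:
  assumes f: "\<forall>i. f i \<in> carrier K"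
  shows "elem f [^]\<^bsub>L\<^esub> (n::nat) = elem (\<lambda>i. f i [^] n)"
proof (induction n)
  case (Suc n)
  then show ?case
    using elem_mult[of "\<lambda>i. f i [^] n" f] f by simp
qed (simp add: L_simps)

lemma ultra_value_Infty: "\<forall>\<^sub>F i in U. h i = Infty \<Longrightarrow> ultra_value U G h = Infty"
  by (simp add: ultra_value_def)

lemma ultra_value_Val:
  assumes "\<forall>\<^sub>F i in U. h i = Val (g i)"
  shows "ultra_value U G h = Val (gamma g)"
proof -
  have "\<forall>\<^sub>F i in U. h i \<noteq> Infty"
    using assms by eventually_elim simp
  moreover have "gamma (\<lambda>i. case h i of Val g \<Rightarrow> g | Infty \<Rightarrow> \<one>\<^bsub>G\<^esub>) = gamma g"
  proof (rule class_eqI)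
    show "\<forall>\<^sub>F i in U. (case h i of Val g \<Rightarrow> g | Infty \<Rightarrow> \<one>\<^bsub>G\<^esub>) = g i"
      using assms by eventually_elim simp
  qed
  ultimately show ?thesis
    by (simp add: ultra_value_def eventually_not_iff)
qed

text \<open>
  Limits of values are computed by reducing everything to the value group: an ultrafilter
  decides whether almost all values are infinite or almost all of them are finite.
\<close>

lemma ultra_value_cases:
  assumes "\<forall>i. h i \<in> ext_values G"
  obtains (Infty) "\<forall>\<^sub>F i in U. h i = Infty" "ultra_value U G h = Infty"
    | (Val) g where "\<forall>i. g i \<in> carrier G" "\<forall>\<^sub>F i in U. h i = Val (g i)"
      "ultra_value U G h = Val (gamma g)"
proof (cases "\<forall>\<^sub>F i in U. h i = Infty")
  case True
  then show thesis
    using Infty ultra_value_Infty by blast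
next
  case False
  define g where "g i = (case h i of Val g \<Rightarrow> g | Infty \<Rightarrow> \<one>\<^bsub>G\<^esub>)" for i
  have "g i \<in> carrier G" for i
    using assms[rule_format, of i] by (auto simp: g_def ext_values_def split: ext_value.splits)
  moreover have "\<forall>\<^sub>F i in U. h i \<noteq> Infty"
    using False by (simp add: eventually_not_iff)
  then have "\<forall>\<^sub>F i in U. h i = Val (g i)"
    by eventually_elim (auto simp: g_def split: ext_value.splits)
  ultimately show thesis
    using Val ultra_value_Val by blast
qed

lemma ultra_value_in_H:
  assumes "\<forall>i. h i \<in> ext_values G"
  shows "ultra_value U G h \<in> ext_values H"
  using ultra_value_cases[OF assms] by cases (auto simp: ext_values_def gamma_in_H)

lemma ultra_value_cong:
  assumes "\<forall>i. h i \<in> ext_values G" "\<forall>\<^sub>F i in U. h i = k i"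
  shows "ultra_value U G h = ultra_value U G k"
  using assms(1)
proof (cases rule: ultra_value_cases)
  case Infty
  have "\<forall>\<^sub>F i in U. k i = Infty"
    using assms(2) Infty(1) by eventually_elim simp
  then show ?thesis
    using Infty ultra_value_Infty by simp
next
  case (Val g)
  have "\<forall>\<^sub>F i in U. k i = Val (g i)"
    using assms(2) Val(2) by eventually_elim simp
  then show ?thesis
    using Val ultra_value_Val by simp
qed

lemma ultra_value_le:
  assumes h: "\<forall>i. h i \<in> ext_values G" and k: "\<forall>i. k i \<in> ext_values G"
  shows "vle H (ultra_value U G h) (ultra_value U G k) \<longleftrightarrow> (\<forall>\<^sub>F i in U. vle G (h i) (k i))"
  using k
proof (cases rule: ultra_value_cases)
  case Infty
  have "\<forall>\<^sub>F i in U. vle G (h i) (k i)"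
    using Infty(1) by eventually_elim simp
  then show ?thesis
    using Infty by simp
next
  case k: (Val g)
  from h show ?thesis
  proof (cases rule: ultra_value_cases)
    case Infty
    have "\<forall>\<^sub>F i in U. \<not> vle G (h i) (k i)"
      using Infty(1) k(2) by eventually_elim simp
    then show ?thesis
      using Infty k by (simp add: eventually_not_iff)
  next
    case (Val f)
    have "\<forall>\<^sub>F i in U. vle G (h i) (k i) = (f i \<preceq>\<^bsub>G\<^esub> g i)"
      using Val(2) k(2) by eventually_elim simp
    then show ?thesis
      using Val k by (simp add: gamma_le eventually_subst)
  qed
qed

lemma ultra_value_eq_iff:
  assumes h: "\<forall>i. h i \<in> ext_values G" and k: "\<forall>i. k i \<in> ext_values G"
  shows "ultra_value U G h = ultra_value U G k \<longleftrightarrow> (\<forall>\<^sub>F i in U. h i = k i)"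
proof
  assume "ultra_value U G h = ultra_value U G k"
  then have "\<forall>\<^sub>F i in U. vle G (h i) (k i)" "\<forall>\<^sub>F i in U. vle G (k i) (h i)"
    using ultra_value_le[OF h k] ultra_value_le[OF k h] H.vle_refl ultra_value_in_H h k by auto
  then show "\<forall>\<^sub>F i in U. h i = k i"
    by eventually_elim (use h k value_group.vle_antisym in blast)
qed (rule ultra_value_cong[OF h])

lemma ultra_value_less:
  assumes h: "\<forall>i. h i \<in> ext_values G" and k: "\<forall>i. k i \<in> ext_values G"
  shows "vless H (ultra_value U G h) (ultra_value U G k) \<longleftrightarrow> (\<forall>\<^sub>F i in U. vless G (h i) (k i))"
  unfolding vless_def
  by (simp add: ultra_value_le[OF h k] ultra_value_eq_iff[OF h k] eventually_conj_iff
      eventually_not_iff)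

lemma ultra_value_add:
  assumes h: "\<forall>i. h i \<in> ext_values G" and k: "\<forall>i. k i \<in> ext_values G"
  shows "ultra_value U G (\<lambda>i. vadd G (h i) (k i)) = vadd H (ultra_value U G h) (ultra_value U G k)"
  using h
proof (cases rule: ultra_value_cases)
  case Infty
  have "\<forall>\<^sub>F i in U. vadd G (h i) (k i) = Infty"
    using Infty(1) by eventually_elim simp
  then show ?thesis
    using Infty ultra_value_Infty by simp
next
  case h: (Val f)
  from k show ?thesis
  proof (cases rule: ultra_value_cases)
    case Infty
    have "\<forall>\<^sub>F i in U. vadd G (h i) (k i) = Infty"
      using Infty(1) h(2) by eventually_elim simp
    then show ?thesis
      using Infty h ultra_value_Infty by simp
  next
    case (Val g)
    have "\<forall>\<^sub>F i in U. vadd G (h i) (k i) = Val (f i \<otimes>\<^bsub>G\<^esub> g i)"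
      using Val(2) h(2) by eventually_elim simp
    then show ?thesis
      using Val h ultra_value_Val by (simp add: gamma_mult)
  qed
qed

lemma w_elem:
  assumes f: "\<forall>i. f i \<in> carrier K"
  shows "w (elem f) = ultra_value U G (\<lambda>i. v (f i))"
  unfolding ultra_valuation_def
proof (rule ultra_value_cong)
  show "\<forall>i. v (representative (elem f) i) \<in> ext_values G"
    using representative_class(1)[OF f] v_closed by blast
  show "\<forall>\<^sub>F i in U. v (representative (elem f) i) = v (f i)"
    using representative_class(2)[OF f] by eventually_elim simp
qed

lemma valued_field_L: "valued_field L H w"
proof
  show w_zero: "w \<zero>\<^bsub>L\<^esub> = Infty"
    by (simp add: L_simps w_elem ultra_value_Infty v_zero)
  show "w ` (carrier L - {\<zero>\<^bsub>L\<^esub>}) = Val ` carrier H"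
  proof (intro equalityI subsetI)
    fix y assume "y \<in> w ` (carrier L - {\<zero>\<^bsub>L\<^esub>})"
    then obtain f where f: "\<forall>i. f i \<in> carrier K" "y = w (elem f)" "elem f \<noteq> \<zero>\<^bsub>L\<^esub>"
      by (auto elim!: carrier_L_E)
    have vf: "\<forall>i. v (f i) \<in> ext_values G"
      using f v_closed by blast
    show "y \<in> Val ` carrier H"
      using vf
    proof (cases rule: ultra_value_cases)
      case Infty
      have "\<forall>\<^sub>F i in U. f i = \<zero>"
        using Infty(1) by eventually_elim (use f v_eq_Infty_iff in blast)
      then show ?thesis
        using f(3) class_eqI[of f "\<lambda>i. \<zero>"] by (simp add: L_simps(3))
    next
      case (Val g)
      then show ?thesis
        using f by (simp add: w_elem gamma_in_H)
    qed
  next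
    fix y assume "y \<in> Val ` carrier H"
    then obtain g where g: "\<forall>i. g i \<in> carrier G" "y = Val (gamma g)"
      by (auto elim!: carrier_H_E)
    have "\<exists>f. \<forall>i. f i \<in> carrier K \<and> v (f i) = Val (g i)"
      using g v_surj by (intro choice) metis
    then obtain f where f: "\<forall>i. f i \<in> carrier K" "\<forall>i. v (f i) = Val (g i)"
      by blast
    then have "w (elem f) = y"
      using g by (simp add: w_elem ultra_value_Val)
    moreover have "elem f \<noteq> \<zero>\<^bsub>L\<^esub>"
      using \<open>w (elem f) = y\<close> w_zero g by auto
    ultimately show "y \<in> w ` (carrier L - {\<zero>\<^bsub>L\<^esub>})"
      using elem_in_L f by blast
  qed
next
  fix a b assume "a \<in> carrier L" "b \<in> carrier L"
  then obtain f g where f: "\<forall>i. f i \<in> carrier K" "a = elem f" and g: "\<forall>i. g i \<in> carrier K" "b = elem g"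
    by (auto elim!: carrier_L_E)
  have vf: "\<forall>i. v (f i) \<in> ext_values G" and vg: "\<forall>i. v (g i) \<in> ext_values G"
    and vs: "\<forall>i. v (f i \<oplus> g i) \<in> ext_values G"
    using f g v_closed by auto
  show "w (a \<otimes>\<^bsub>L\<^esub> b) = vadd H (w a) (w b)"
    using f g by (simp add: elem_mult w_elem v_mult ultra_value_add[OF vf vg])
  have sum: "w (a \<oplus>\<^bsub>L\<^esub> b) = ultra_value U G (\<lambda>i. v (f i \<oplus> g i))"
    using f g by (simp add: elem_add w_elem)
  have wa: "w a = ultra_value U G (\<lambda>i. v (f i))" and wb: "w b = ultra_value U G (\<lambda>i. v (g i))"
    using f g by (simp_all add: w_elem)
  have v_min: "vle G (if vle G (v (f i)) (v (g i)) then v (f i) else v (g i)) (v (f i \<oplus> g i))" for i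
    using v_add[of "f i" "g i"] f(1) g(1) by (simp add: vmin_def)
  show "vle H (vmin H (w a) (w b)) (w (a \<oplus>\<^bsub>L\<^esub> b))"
  proof (cases "vle H (w a) (w b)")
    case True
    then have "\<forall>\<^sub>F i in U. vle G (v (f i)) (v (g i))"
      by (simp add: wa wb ultra_value_le[OF vf vg])
    then have "\<forall>\<^sub>F i in U. vle G (v (f i)) (v (f i \<oplus> g i))"
      by eventually_elim (use v_min in \<open>metis\<close>)
    then show ?thesis
      using True by (simp add: vmin_def sum wa ultra_value_le[OF vf vs])
  next
    case False
    then have "\<forall>\<^sub>F i in U. \<not> vle G (v (f i)) (v (g i))"
      by (simp add: wa wb ultra_value_le[OF vf vg] eventually_not_iff)
    then have "\<forall>\<^sub>F i in U. vle G (v (g i)) (v (f i \<oplus> g i))"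
      by eventually_elim (use v_min in \<open>metis\<close>)
    then show ?thesis
      using False by (simp add: vmin_def sum wb ultra_value_le[OF vg vs])
  qed
qed

text \<open>
  Closedness of the value is part of the induction because the operations on classes are
  componentwise only for functions into the carrier.
\<close>

lemma interp_elem:
  assumes e: "\<forall>n i. e n i \<in> carrier K"
  shows "(\<forall>i. interp K (\<lambda>n. e n i) t \<in> carrier K) \<and>
    interp L (\<lambda>n. elem (e n)) t = elem (\<lambda>i. interp K (\<lambda>n. e n i) t)"
  using e by (induction t) (simp_all add: L_simps elem_add elem_mult elem_uminus)

section \<open>The theorem of Los and the diagonal embedding\<close>

text \<open>
  An environment of classes is given by representatives \<open>e n\<close>. Atomic formulas hold by the
  definition of the ultrapower and the connectives commute with an ultrafilter. In the
  quantifier case a single class \<open>f\<close> collects a counterexample from every component that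
  has one, so that truth at \<open>f\<close> already implies the universal statement in almost all
  components.
\<close>

theorem Los:
  assumes "\<forall>n i. e n i \<in> carrier K"
  shows "sat L H w (\<lambda>n. elem (e n)) \<phi> \<longleftrightarrow> (\<forall>\<^sub>F i in U. sat K G v (\<lambda>n. e n i) \<phi>)"
  using assms
proof (induction \<phi> arbitrary: e)
  case (FEq s t)
  then show ?case
    using interp_elem[of e s] interp_elem[of e t] by (simp add: class_eq_iff)
next
  case (FVdvd s t)
  then show ?case
    using interp_elem[of e s] interp_elem[of e t] v_closed by (simp add: w_elem ultra_value_le)
next
  case (FNot \<phi>)
  then show ?case
    by (simp add: eventually_not_iff)
next
  case (FAnd \<phi> \<psi>)
  then show ?case
    by (simp add: eventually_conj_iff)
next
  case (FAll m \<phi>)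
  have inst: "sat L H w ((\<lambda>n. elem (e n))(m := elem f)) \<phi> \<longleftrightarrow>
      (\<forall>\<^sub>F i in U. sat K G v ((\<lambda>n. e n i)(m := f i)) \<phi>)" if f: "\<forall>i. f i \<in> carrier K" for f
  proof -
    have "(\<lambda>n. elem (e n))(m := elem f) = (\<lambda>n. elem ((e(m := f)) n))"
      and "(\<lambda>n. e n i)(m := f i) = (\<lambda>n. (e(m := f)) n i)" for i
      by (rule ext, simp)+
    then show ?thesis
      using FAll.IH[of "e(m := f)"] FAll.prems f by simp
  qed
  show ?case
  proof
    assume L: "sat L H w (\<lambda>n. elem (e n)) (FAll m \<phi>)"
    \<comment> \<open>A counterexample in component i if there is one; otherwise any element of the carrier.\<close>
    define f where "f i = (if \<exists>a\<in>carrier K. \<not> sat K G v ((\<lambda>n. e n i)(m := a)) \<phi>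
      then SOME a. a \<in> carrier K \<and> \<not> sat K G v ((\<lambda>n. e n i)(m := a)) \<phi> else \<zero>)" for i
    have f: "f i \<in> carrier K"
      and bad: "sat K G v ((\<lambda>n. e n i)(m := f i)) \<phi> \<Longrightarrow> sat K G v (\<lambda>n. e n i) (FAll m \<phi>)" for i
    proof -
      have *: "f i \<in> carrier K \<and> \<not> sat K G v ((\<lambda>n. e n i)(m := f i)) \<phi>"
        if "\<exists>a\<in>carrier K. \<not> sat K G v ((\<lambda>n. e n i)(m := a)) \<phi>"
        using that unfolding f_def
        by (simp, intro someI_ex[of "\<lambda>a. a \<in> carrier K \<and> \<not> sat K G v ((\<lambda>n. e n i)(m := a)) \<phi>"]) auto
      then show "f i \<in> carrier K"
        by (cases "\<exists>a\<in>carrier K. \<not> sat K G v ((\<lambda>n. e n i)(m := a)) \<phi>") (auto simp: f_def)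
      show "sat K G v (\<lambda>n. e n i) (FAll m \<phi>)" if "sat K G v ((\<lambda>n. e n i)(m := f i)) \<phi>"
        using * that by auto
    qed
    have "\<forall>\<^sub>F i in U. sat K G v ((\<lambda>n. e n i)(m := f i)) \<phi>"
      using L inst[of f] f elem_in_L[of f] by simp
    then show "\<forall>\<^sub>F i in U. sat K G v (\<lambda>n. e n i) (FAll m \<phi>)"
      by eventually_elim (rule bad)
  next
    assume K: "\<forall>\<^sub>F i in U. sat K G v (\<lambda>n. e n i) (FAll m \<phi>)"
    have "sat L H w ((\<lambda>n. elem (e n))(m := elem f)) \<phi>" if f: "\<forall>i. f i \<in> carrier K" for f
      unfolding inst[OF f] using K by eventually_elim (use f in simp)
    then show "sat L H w (\<lambda>n. elem (e n)) (FAll m \<phi>)"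
      by (auto elim!: carrier_L_E)
  qed
qed

abbreviation diag where "diag a \<equiv> elem (\<lambda>i. a)"
abbreviation diag_value where "diag_value g \<equiv> gamma (\<lambda>i. g)"

lemma map_diag_value: "map_ext_value diag_value \<gamma> = ultra_value U G (\<lambda>i. \<gamma>)"
proof (cases \<gamma>)
  case (Val g)
  then show ?thesis
    using ultra_value_Val[of "\<lambda>i. \<gamma>" "\<lambda>i. g"] by simp
qed (simp add: ultra_value_Infty)

lemma diag_hom: "diag \<in> ring_hom K L"
  by (rule ring_hom_memI) (simp_all add: elem_in_L elem_mult elem_add L_simps(2))

lemma elementary_extension_diag: "elementary_extension K G v L H w diag diag_value"
proof -
  have "valued_field_extension K G v L H w diag diag_value"
    unfolding valued_field_extension_def
  proof (intro conjI ballI)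
    show "valued_field K G v"
      by (rule valued_field_axioms)
    show "diag_value \<in> hom G H"
      by (rule homI) (simp_all add: gamma_in_H gamma_mult)
  qed (auto simp: valued_field_L diag_hom inj_on_def class_eq_iff eventually_const_iff gamma_le
      w_elem map_diag_value)
  moreover have "sat K G v e \<phi> \<longleftrightarrow> sat L H w (diag \<circ> e) \<phi>" if "range e \<subseteq> carrier K" for e \<phi>
    using Los[of "\<lambda>n i. e n" \<phi>] that by (auto simp: comp_def eventually_const_iff)
  ultimately show ?thesis
    by (simp add: elementary_extension_def)
qed

lemma eval_elem:
  assumes f: "\<forall>i. f i \<in> carrier K" and "set q \<subseteq> carrier K"
  shows "L.eval (map diag q) (elem f) = elem (\<lambda>i. eval q (f i))"
  using assms(2)
proof (induction q)
  case (Cons a q)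
  then show ?case
    using f by (simp add: elem_pow elem_mult elem_add eval_in_carrier)
qed (simp add: L_simps)

text \<open>
  If \<open>f\<close> were algebraic over the constants, then almost all of its components would be roots
  of one nonzero polynomial over \<open>K\<close>. There are only finitely many roots in \<open>K\<close>, and each
  of them is avoided almost everywhere.
\<close>

lemma transcendental_elem:
  assumes f: "\<forall>i. f i \<in> carrier K" and avoids: "\<And>a. a \<in> carrier K \<Longrightarrow> \<forall>\<^sub>F i in U. f i \<noteq> a"
  shows "(L.transcendental over (diag ` carrier K)) (elem f)"
proof (rule ccontr)
  assume "\<not> (L.transcendental over (diag ` carrier K)) (elem f)"
  then have alg: "(L.algebraic over (diag ` carrier K)) (elem f)"
    by (simp add: over_def)
  interpret diag: ring_hom_ring K L diag
    by (rule ring_hom_ringI2) (use ring_axioms L.ring_axioms diag_hom in auto)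
  have "subring (diag ` carrier K) L"
    using diag.img_is_subring[OF carrier_is_subring] .
  then obtain p where p: "p \<in> carrier ((diag ` carrier K)[X]\<^bsub>L\<^esub>)" "p \<noteq> []" "L.eval p (elem f) = \<zero>\<^bsub>L\<^esub>"
    using L.algebraicE[OF _ elem_in_L[OF f] alg] by blast
  then have set_p: "set p \<subseteq> diag ` carrier K" and lead: "hd p \<noteq> \<zero>\<^bsub>L\<^esub>"
    by (auto simp: univ_poly_carrier[symmetric] polynomial_def)
  then have "p \<in> map diag ` lists (carrier K)"
    by (simp add: lists_image[symmetric] in_lists_conv_set subset_eq)
  then obtain q where q: "set q \<subseteq> carrier K" "p = map diag q"
    by (auto simp: in_lists_conv_set)
  have "q \<noteq> []"
    using p q by simp
  then have "hd p = diag (hd q)"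
    unfolding q(2) by (rule hd_map)
  then have "hd q \<noteq> \<zero>"
    using lead L_simps(3) by metis
  then have poly: "q \<in> carrier (poly_ring K)"
    using q(1) unfolding univ_poly_carrier[symmetric] polynomial_def by blast
  have "\<forall>\<^sub>F i in U. \<forall>a\<in>{a. is_root q a}. f i \<noteq> a"
    using avoids
    by (subst eventually_ball_finite_distrib[OF finite_number_of_roots[OF poly]])
      (auto simp: is_root_def)
  moreover have "elem (\<lambda>i. eval q (f i)) = elem (\<lambda>i. \<zero>)"
    using p(3) eval_elem[OF f q(1)] L_simps(3) unfolding q(2) by metis
  then have "\<forall>\<^sub>F i in U. eval q (f i) = \<zero>"
    using class_eq_iff[of "\<lambda>i. eval q (f i)" "carrier K" "\<lambda>i. \<zero>"]
      eval_in_carrier[OF q(1)] f zero_closed by blast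
  ultimately have "\<forall>\<^sub>F i in U. False"
    by eventually_elim (use f \<open>q \<noteq> []\<close> in \<open>auto simp: is_root_def\<close>)
  then show False
    by (simp add: eventually_const_iff)
qed

text \<open>
  The valuation of the ultrapower compares the distances from \<open>f\<close> to the constants
  componentwise, so that \<open>f\<close> lies in a ball over \<open>K\<close> if and only if almost all of its
  components do.
\<close>

lemma appr_elem:
  assumes f: "\<forall>i. f i \<in> carrier K"
  shows "appr K G L H w diag diag_value (elem f) =
    {(k, \<gamma>, S) | k \<gamma> S. \<gamma> \<in> radii k \<and>
       S = {c \<in> carrier K. \<forall>\<^sub>F i in U. in_radius k \<gamma> (v (f i \<ominus> c))} \<and> S \<noteq> {}}"
proof -
  have dist: "w (elem f \<ominus>\<^bsub>L\<^esub> diag c) = ultra_value U G (\<lambda>i. v (f i \<ominus> c))"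
    and val: "\<forall>i. v (f i \<ominus> c) \<in> ext_values G" if "c \<in> carrier K" for c
    using f that v_closed by (simp_all add: elem_minus w_elem)
  have Closed: "vle H (map_ext_value diag_value \<gamma>) (w (elem f \<ominus>\<^bsub>L\<^esub> diag c)) \<longleftrightarrow>
      (\<forall>\<^sub>F i in U. in_radius Closed \<gamma> (v (f i \<ominus> c)))"
    and Open: "vless H (map_ext_value diag_value \<gamma>) (w (elem f \<ominus>\<^bsub>L\<^esub> diag c)) \<longleftrightarrow>
      (\<forall>\<^sub>F i in U. in_radius Open \<gamma> (v (f i \<ominus> c)))"
    if "\<gamma> \<in> ext_values G" "c \<in> carrier K" for \<gamma> c
    using that
    by (simp_all add: dist map_diag_value ultra_value_le ultra_value_less val in_radius_def)
  show ?thesis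
  proof (rule Set.set_eqI)
    fix B :: "('a, 'g) vball"
    obtain k \<gamma> S where B: "B = (k, \<gamma>, S)" by (cases B)
    show "B \<in> appr K G L H w diag diag_value (elem f) \<longleftrightarrow> B \<in> {(k, \<gamma>, S) | k \<gamma> S. \<gamma> \<in> radii k \<and>
        S = {c \<in> carrier K. \<forall>\<^sub>F i in U. in_radius k \<gamma> (v (f i \<ominus> c))} \<and> S \<noteq> {}}"
    proof (cases k)
      case C: Closed
      then show ?thesis
        by (cases "\<gamma> \<in> ext_values G") (simp_all add: B appr_def radii_def Closed cong: conj_cong)
    next
      case O: Open
      then show ?thesis
        using radii_subset[of \<gamma> Open]
        by (cases "\<gamma> \<in> Val ` carrier G")
          (simp_all add: B appr_def radii_def Open cong: conj_cong)
    qed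
  qed
qed

end

section \<open>Realizing an approximation type\<close>

context nontrivial_type
begin

text \<open>
  The three cases are exhaustive because a type with a common point that is not
  value-extending is residue-extending.
\<close>

lemma satisfiable:
  assumes "value_extending K A \<Longrightarrow> dense_group G \<and> carrier G \<noteq> {\<one>\<^bsub>G\<^esub>}"
    and "residue_extending K A \<Longrightarrow> infinite (carrier (residue_field K G v))"
    and "finite P" "P \<subseteq> A" "finite N" "N \<subseteq> vballs K G v - A"
  shows "\<exists>a\<in>carrier K. (\<forall>k \<gamma> S. (k, \<gamma>, S) \<in> P \<longrightarrow> a \<in> S) \<and> (\<forall>k \<gamma> S. (k, \<gamma>, S) \<in> N \<longrightarrow> a \<notin> S)"
proof -
  consider "inter_balls K A = {}" | "value_extending K A"
    | "inter_balls K A \<noteq> {}" "\<not> value_extending K A" by blast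
  then show ?thesis
  proof cases
    case 1
    then show ?thesis
      using satisfiable_if_no_common_point assms(3-6) by blast
  next
    case 2
    then show ?thesis
      using satisfiable_if_value_extending[OF 2 _ _ assms(3-6)] assms(1) by blast
  next
    case 3
    then show ?thesis
      using satisfiable_if_smallest_ball[OF 3 _ assms(3-6)] assms(2)
        residue_extending_if_smallest_ball by blast
  qed
qed

text \<open>
  The ultrafilter contains every ball of \<open>A\<close> and the complement of every other ball.
  Satisfiability of finitely many such conditions is exactly the finite intersection property
  of these sets.
\<close>

lemma ultrafilter_of_type:
  assumes "value_extending K A \<Longrightarrow> dense_group G \<and> carrier G \<noteq> {\<one>\<^bsub>G\<^esub>}"
    and "residue_extending K A \<Longrightarrow> infinite (carrier (residue_field K G v))"
  obtains U :: "'a filter" where "ultrafilter U" "\<forall>\<^sub>F a in U. a \<in> carrier K"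
    "\<And>k c \<gamma>. \<lbrakk>c \<in> carrier K; \<gamma> \<in> radii k\<rbrakk> \<Longrightarrow>
      (\<forall>\<^sub>F a in U. in_radius k \<gamma> (v (a \<ominus> c))) \<longleftrightarrow> ball k c \<gamma> \<in> A"
proof -
  define cond where "cond B = (if B \<in> A then snd (snd B) else carrier K - snd (snd B))" for B
  have "\<Inter>T \<noteq> {}" if "finite T" "T \<subseteq> cond ` vballs K G v" for T
  proof -
    obtain M where M: "M \<subseteq> vballs K G v" "finite M" "T = cond ` M"
      using finite_subset_image[OF \<open>finite T\<close> \<open>T \<subseteq> cond ` vballs K G v\<close>] by blast
    obtain a where "a \<in> carrier K" "\<forall>k \<gamma> S. (k, \<gamma>, S) \<in> M \<inter> A \<longrightarrow> a \<in> S"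
        "\<forall>k \<gamma> S. (k, \<gamma>, S) \<in> M - A \<longrightarrow> a \<notin> S"
      using satisfiable[OF assms, of "M \<inter> A" "M - A"] M by blast
    then have "a \<in> \<Inter>T"
      using M by (auto simp: cond_def)
    then show ?thesis by blast
  qed
  then obtain U where U: "ultrafilter U" and ev: "\<And>S. S \<in> cond ` vballs K G v \<Longrightarrow> \<forall>\<^sub>F a in U. a \<in> S"
    using ultrafilter_extending by metis
  interpret ultrafilter U by (rule U)
  have cond: "\<forall>\<^sub>F a in U. a \<in> carrier K \<and> (in_radius k \<gamma> (v (a \<ominus> c)) \<longleftrightarrow> ball k c \<gamma> \<in> A)"
    if "c \<in> carrier K" "\<gamma> \<in> radii k" for k c \<gamma>
  proof -
    have "\<forall>\<^sub>F a in U. a \<in> cond (ball k c \<gamma>)"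
      using that by (intro ev imageI) (auto simp: vballs_eq)
    then show ?thesis
      by eventually_elim (auto simp: cond_def ball_def split: if_splits)
  qed
  have "\<forall>\<^sub>F a in U. a \<in> carrier K"
    using cond[of \<zero> Infty Closed] by (simp add: radii_def ext_values_def eventually_conj_iff)
  moreover have "(\<forall>\<^sub>F a in U. in_radius k \<gamma> (v (a \<ominus> c))) \<longleftrightarrow> ball k c \<gamma> \<in> A"
    if "c \<in> carrier K" "\<gamma> \<in> radii k" for k c \<gamma>
  proof -
    have "\<forall>\<^sub>F a in U. in_radius k \<gamma> (v (a \<ominus> c)) \<longleftrightarrow> ball k c \<gamma> \<in> A"
      using cond[OF that] by (simp add: eventually_conj_iff)
    then have "(\<forall>\<^sub>F a in U. in_radius k \<gamma> (v (a \<ominus> c))) \<longleftrightarrow> (\<forall>\<^sub>F a in U. ball k c \<gamma> \<in> A)"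
      by (rule eventually_subst)
    then show ?thesis
      by (simp add: eventually_const_iff)
  qed
  ultimately show thesis
    using that U by blast
qed

lemma points_eq_centers:
  assumes B: "(k, \<gamma>, S) \<in> A"
  shows "S = {c \<in> carrier K. ball k c \<gamma> \<in> A}"
proof -
  note V = in_vballs[OF B]
  have "\<gamma> \<in> radii k"
    using V by (rule vball_cases)
  have "c \<in> S" if c: "c \<in> carrier K" "ball k c \<gamma> \<in> A" for c
  proof -
    have "ball k c \<gamma> = (k, \<gamma>, S)"
      using ball_radius_unique[OF B] c(2) by (simp add: ball_def)
    then show ?thesis
      using center_in_ball[OF c(1) \<open>\<gamma> \<in> radii k\<close>] c(1) by (auto simp: ball_def)
  qed
  moreover have "c \<in> carrier K \<and> ball k c \<gamma> \<in> A" if "c \<in> S" for c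
    using vball_around[OF V that] B by simp
  ultimately show ?thesis by blast
qed

text \<open>
  An approximation type is determined by the pairs of a center and a radius for which
  the ball belongs to it. This matches the shape of the approximation type of an element,
  whose members are given by their sets of centers.
\<close>

lemma type_eq_centers:
  "{(k, \<gamma>, S) | k \<gamma> S. \<gamma> \<in> radii k \<and> S = {c \<in> carrier K. ball k c \<gamma> \<in> A} \<and> S \<noteq> {}} = A"
proof (intro equalityI subsetI)
  fix B assume "B \<in> {(k, \<gamma>, S) | k \<gamma> S. \<gamma> \<in> radii k \<and>
    S = {c \<in> carrier K. ball k c \<gamma> \<in> A} \<and> S \<noteq> {}}"
  then obtain k \<gamma> c where B: "B = (k, \<gamma>, {c \<in> carrier K. ball k c \<gamma> \<in> A})" and c: "ball k c \<gamma> \<in> A"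
    by blast
  then obtain S where S: "ball k c \<gamma> = (k, \<gamma>, S)"
    by (simp add: ball_def)
  then show "B \<in> A"
    using points_eq_centers[of k \<gamma> S] B c by simp
next
  fix B assume "B \<in> A"
  obtain k \<gamma> S where B: "B = (k, \<gamma>, S)" by (cases B)
  have V: "(k, \<gamma>, S) \<in> vballs K G v"
    using in_vballs \<open>B \<in> A\<close> B by blast
  obtain c where "c \<in> S" "\<gamma> \<in> radii k"
    using V by (rule vball_cases)
  moreover have "S = {c \<in> carrier K. ball k c \<gamma> \<in> A}"
    using points_eq_centers \<open>B \<in> A\<close> B by blast
  ultimately show "B \<in> {(k, \<gamma>, S) | k \<gamma> S. \<gamma> \<in> radii k \<and>
    S = {c \<in> carrier K. ball k c \<gamma> \<in> A} \<and> S \<noteq> {}}"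
    using B by blast
qed

lemma singleton_not_in_type: "c \<in> carrier K \<Longrightarrow> ball Closed c Infty \<notin> A"
  using not_trivial by (auto simp: trivial_type_def supp_def ball_def)

end

theorem theorem4p5:
  fixes K :: "'a ring" and G :: "'g ordered_group" and v :: "'a \<Rightarrow> 'g ext_value"
    and A :: "('a, 'g) vball set"
  assumes "valued_field K G v"
    and "approximation_type K G v A"
    and "\<not> trivial_type A"
    and "value_extending K A \<Longrightarrow> dense_group G \<and> carrier G \<noteq> {\<one>\<^bsub>G\<^esub>}"
    and "residue_extending K A \<Longrightarrow> infinite (carrier (residue_field K G v))"
  shows "\<exists>(L :: ('a set \<Rightarrow> 'a) set ring) (H :: ('a set \<Rightarrow> 'g) set ordered_group)
           (w :: ('a set \<Rightarrow> 'a) set \<Rightarrow> ('a set \<Rightarrow> 'g) set ext_value)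
           (\<iota> :: 'a \<Rightarrow> ('a set \<Rightarrow> 'a) set) (j :: 'g \<Rightarrow> ('a set \<Rightarrow> 'g) set) x.
           elementary_extension K G v L H w \<iota> j \<and>
           x \<in> carrier L \<and>
           (ring.transcendental L over (\<iota> ` carrier K)) x \<and>
           appr K G L H w \<iota> j x = A"
proof -
  interpret nontrivial_type K G v A
    using assms(1-3) by (simp add: nontrivial_type_def nontrivial_type_axioms_def)
  obtain U0 :: "'a filter" where U0: "ultrafilter U0" "\<forall>\<^sub>F a in U0. a \<in> carrier K"
    and U0_type: "\<And>k c \<gamma>. \<lbrakk>c \<in> carrier K; \<gamma> \<in> radii k\<rbrakk> \<Longrightarrow>
      (\<forall>\<^sub>F a in U0. in_radius k \<gamma> (v (a \<ominus>\<^bsub>K\<^esub> c))) \<longleftrightarrow> ball k c \<gamma> \<in> A"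
    using ultrafilter_of_type[OF assms(4,5)] by metis
  \<comment> \<open>The index set consists of sets of elements; singletons embed the field into it.\<close>
  define U where "U = filtermap (\<lambda>a. {a}) U0"
  \<comment> \<open>The identity, read along singletons; the default value keeps it in the carrier.\<close>
  define f where "f S = (if the_elem S \<in> carrier K then the_elem S else \<zero>\<^bsub>K\<^esub>)" for S
  have f: "\<forall>S. f S \<in> carrier K"
    by (simp add: f_def)
  have "ultrafilter U"
    unfolding U_def using U0(1) by (rule ultrafilter_filtermap)
  then interpret ultrapower K G v U
    by (simp add: ultrapower_def valued_field_axioms)
  have ev: "(\<forall>\<^sub>F S in U. Q (f S)) \<longleftrightarrow> (\<forall>\<^sub>F a in U0. Q a)" for Q
  proof -
    have "\<forall>\<^sub>F a in U0. Q (f {a}) = Q a"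
      using U0(2) by eventually_elim (simp add: f_def)
    then show ?thesis
      by (simp add: U_def eventually_filtermap eventually_subst)
  qed
  have type: "(\<forall>\<^sub>F S in U. in_radius k \<gamma> (v (f S \<ominus>\<^bsub>K\<^esub> c))) \<longleftrightarrow> ball k c \<gamma> \<in> A"
    if "c \<in> carrier K" "\<gamma> \<in> radii k" for k c \<gamma>
    using U0_type[OF that] ev[of "\<lambda>a. in_radius k \<gamma> (v (a \<ominus>\<^bsub>K\<^esub> c))"] by simp
  have "\<forall>\<^sub>F S in U. f S \<noteq> c" if c: "c \<in> carrier K" for c
  proof -
    \<comment> \<open>The single points are the balls of infinite radius, and a nontrivial type has none.\<close>
    have Infty: "Infty \<in> radii Closed"
      by (simp add: radii_def ext_values_def)
    then have "\<forall>\<^sub>F S in U. \<not> in_radius Closed Infty (v (f S \<ominus>\<^bsub>K\<^esub> c))"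
      using type[OF c Infty] singleton_not_in_type[OF c] by (simp add: eventually_not_iff)
    then show ?thesis
      by eventually_elim (use center_in_ball[OF c Infty] in auto)
  qed
  then have "(L.transcendental over (diag ` carrier K)) (elem f)"
    using transcendental_elem[OF f] by blast
  moreover have "appr K G L H w diag diag_value (elem f) = A"
  proof -
    have "{(k, \<gamma>, S) | k \<gamma> S. \<gamma> \<in> radii k \<and>
        S = {c \<in> carrier K. \<forall>\<^sub>F i in U. in_radius k \<gamma> (v (f i \<ominus>\<^bsub>K\<^esub> c))} \<and> S \<noteq> {}} =
      {(k, \<gamma>, S) | k \<gamma> S. \<gamma> \<in> radii k \<and> S = {c \<in> carrier K. ball k c \<gamma> \<in> A} \<and> S \<noteq> {}}"
      by (simp add: type cong: conj_cong)
    then show ?thesis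
      using appr_elem[OF f] type_eq_centers by simp
  qed
  ultimately show ?thesis
    using elementary_extension_diag elem_in_L[OF f] by blast
qed

end
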